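(* Let $n$ be an odd integer with $n \ge 27$ and $n \notin \{33,35,37,41,43,47,51\}$. Then there exists an idempotent symmetric latin square $L$ of order $n$ such that for every row index $r$, column index $c$ and symbol $s$, there is a proper latin subsquare of $L$ whose rows include $r$, whose columns include $c$, and whose symbols include $s$.
   Context: A latin square of order $n$ is an $n\times n$ array with entries from $[n]=\{1,\dots,n\}$ in which every row and every column is a permutation of $[n]$; rows and columns are indexed by $[n]$. It is symmetric if $L_{ij} = L_{ji}$ for all $i,j$, and idempotent if $L_{ii} = i$ for all $i$. A latin subsquare is a sub-array determined by a set $R$ of rows and a set $C$ of columns (not necessarily contiguous) which is itself a latin square on some set of $|R| = |C|$ symbols; it is proper if it is not the whole square. *)

theory Defs
  imports Main
begin

text \<open>A latin square of order n: an n x n array with rows and columns indexed by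
  {1..n}, entries from {1..n}, each row and column a permutation of {1..n}.
  Values of L outside {1..n} x {1..n} are irrelevant.\<close>
definition latin_square :: "nat \<Rightarrow> (nat \<Rightarrow> nat \<Rightarrow> nat) \<Rightarrow> bool" where
  "latin_square n L \<longleftrightarrow>
     (\<forall>i\<in>{1..n}. bij_betw (\<lambda>j. L i j) {1..n} {1..n}) \<and>
     (\<forall>j\<in>{1..n}. bij_betw (\<lambda>i. L i j) {1..n} {1..n})"

definition symmetric_ls :: "nat \<Rightarrow> (nat \<Rightarrow> nat \<Rightarrow> nat) \<Rightarrow> bool" where
  "symmetric_ls n L \<longleftrightarrow> (\<forall>i\<in>{1..n}. \<forall>j\<in>{1..n}. L i j = L j i)"

definition idempotent_ls :: "nat \<Rightarrow> (nat \<Rightarrow> nat \<Rightarrow> nat) \<Rightarrow> bool" where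
  "idempotent_ls n L \<longleftrightarrow> (\<forall>i\<in>{1..n}. L i i = i)"

definition latin_subsquare ::
  "nat \<Rightarrow> (nat \<Rightarrow> nat \<Rightarrow> nat) \<Rightarrow> nat set \<Rightarrow> nat set \<Rightarrow> nat set \<Rightarrow> bool" where
  "latin_subsquare n L R C S \<longleftrightarrow>
     R \<subseteq> {1..n} \<and> C \<subseteq> {1..n} \<and> card R = card C \<and> card S = card R \<and>
     (\<forall>r\<in>R. bij_betw (\<lambda>c. L r c) C S) \<and>
     (\<forall>c\<in>C. bij_betw (\<lambda>r. L r c) R S)"

definition proper_latin_subsquare ::
  "nat \<Rightarrow> (nat \<Rightarrow> nat \<Rightarrow> nat) \<Rightarrow> nat set \<Rightarrow> nat set \<Rightarrow> nat set \<Rightarrow> bool" where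
  "proper_latin_subsquare n L R C S \<longleftrightarrow>
     latin_subsquare n L R C S \<and> \<not> (R = {1..n} \<and> C = {1..n})"

end

theory Submission
  imports Defs "HOL-Library.Product_Plus" "HOL-Library.Z2" "HOL-Library.Cardinality"
    "HOL-Number_Theory.Cong"
begin

text \<open>
  An idempotent symmetric latin square is a commutative idempotent quasigroup.  A triple
  \<open>(r, c, s)\<close> is covered either by a proper subquasigroup or by a subsquare \<open>R \<times> C \<rightarrow> S\<close> with \<open>R\<close>
  and \<open>C\<close> disjoint.  In the Fano plane, a triple of noncollinear points \<open>x, y, z\<close> lies in the
  subsquare \<open>{x, y + z} \<times> {y, x + z} \<rightarrow> {z, x + y}\<close>; in the affine plane of order 3 it lies in the
  subsquare of cosets of the subgroup generated by \<open>x + y + z\<close>.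

  Both kinds of cover survive when every point is replaced by a group of \<open>m\<close> points (group as in
  group divisible designs) and the groups, enlarged by a common set \<open>W\<close> of \<open>w\<close>
  points, are filled with quasigroups of order \<open>m + w\<close> that contain \<open>W\<close>:
  disjointness of \<open>R\<close> and \<open>C\<close> means that the filling is never met. Hence order
  \<open>t\<close> yields order \<open>t m + w\<close>. The fillings come from starters in the cyclic group of
  even order \<open>m\<close>. With \<open>t = 7\<close> this covers every odd \<open>n \<ge> 169\<close> and
  most smaller ones. The remaining orders come from \<open>t = 9\<close>, from the 26 nonzero vectors over the
  field with 3 elements, where \<open>v\<close> and \<open>- v\<close> share a group, and, for 65, 67 and 69, from three
  copies of the doubled affine plane of order 3, glued along points at infinity.
\<close>

section \<open>Commutative idempotent quasigroups\<close>

locale ci_quasigroup =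
  fixes X :: "'a set" and f :: "'a \<Rightarrow> 'a \<Rightarrow> 'a"
  assumes finite_carrier: "finite X"
    and idem: "x \<in> X \<Longrightarrow> f x x = x"
    and closed: "\<lbrakk>x \<in> X; y \<in> X\<rbrakk> \<Longrightarrow> f x y \<in> X"
    and comm: "\<lbrakk>x \<in> X; y \<in> X\<rbrakk> \<Longrightarrow> f x y = f y x"
    and cancel: "\<lbrakk>x \<in> X; y \<in> X; z \<in> X; f x y = f x z\<rbrakk> \<Longrightarrow> y = z"
begin

lemma solvable:
  assumes "x \<in> X" "y \<in> X"
  obtains z where "z \<in> X" "f x z = y"
proof -
  have "inj_on (f x) X" using cancel assms(1) by (blast intro: inj_onI)
  then have "f x ` X = X"
    using closed assms(1) by (intro endo_inj_surj finite_carrier) auto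
  then show thesis using that assms(2) by (metis imageE)
qed

lemma row_bij_betw:
  assumes "x \<in> X" "C \<subseteq> X" "C \<noteq> {}" "card S = card C" and "\<And>y. y \<in> C \<Longrightarrow> f x y \<in> S"
  shows "bij_betw (f x) C S"
proof -
  have inj: "inj_on (f x) C" using cancel assms(1,2) by (blast intro: inj_onI)
  have "finite C" using assms(2) finite_carrier by (rule finite_subset)
  then have "finite S" using assms(3,4) by (metis card_eq_0_iff)
  then have "f x ` C = S"
    using inj assms(4,5) by (intro card_subset_eq) (auto simp: card_image)
  with inj show ?thesis by (simp add: bij_betw_def)
qed

lemma col_bij_betw:
  assumes "y \<in> X" "R \<subseteq> X" "R \<noteq> {}" "card S = card R" and "\<And>x. x \<in> R \<Longrightarrow> f x y \<in> S"
  shows "bij_betw (\<lambda>x. f x y) R S"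
proof -
  have "f x y = f y x" if "x \<in> R" for x using that assms(1,2) comm by blast
  then show ?thesis using row_bij_betw[of y R S] assms by (simp cong: bij_betw_cong)
qed

end

lemma ci_quasigroupI_solvable:
  assumes "finite X" and "\<And>x. x \<in> X \<Longrightarrow> f x x = x"
    and closed: "\<And>x y. \<lbrakk>x \<in> X; y \<in> X\<rbrakk> \<Longrightarrow> f x y \<in> X"
    and "\<And>x y. \<lbrakk>x \<in> X; y \<in> X\<rbrakk> \<Longrightarrow> f x y = f y x"
    and solvable: "\<And>x y. \<lbrakk>x \<in> X; y \<in> X\<rbrakk> \<Longrightarrow> \<exists>z\<in>X. f x z = y"
  shows "ci_quasigroup X f"
proof
  fix x y z assume "x \<in> X" "y \<in> X" "z \<in> X" "f x y = f x z"
  moreover have "inj_on (f x) X"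
    using \<open>finite X\<close> solvable[OF \<open>x \<in> X\<close>] by (intro finite_surj_inj) (auto simp: image_iff)
  ultimately show "y = z" by (blast dest: inj_onD)
qed (use assms in blast)+

lemma ci_quasigroup_of_blocks:
  assumes "finite X"
    and block: "\<And>x y. \<lbrakk>x \<in> X; y \<in> X\<rbrakk> \<Longrightarrow> \<exists>B. B \<subseteq> X \<and> x \<in> B \<and> y \<in> B \<and> ci_quasigroup B f"
  shows "ci_quasigroup X f"
proof (rule ci_quasigroupI_solvable)
  show "f x x = x" if "x \<in> X" for x
    using block[OF that that] ci_quasigroup.idem by metis
  fix x y assume xy: "x \<in> X" "y \<in> X"
  then obtain B where B: "B \<subseteq> X" "x \<in> B" "y \<in> B" and "ci_quasigroup B f"
    using block by blast
  then interpret ci_quasigroup B f by simp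
  show "f x y \<in> X" using closed B by blast
  show "f x y = f y x" using comm B by blast
  show "\<exists>z\<in>X. f x z = y" using solvable B by (metis subsetD)
qed fact

inductive covered :: "'a set \<Rightarrow> ('a \<Rightarrow> 'a \<Rightarrow> 'a) \<Rightarrow> 'a \<Rightarrow> 'a \<Rightarrow> 'a \<Rightarrow> bool"
  for X f r c s where
  closed: "\<lbrakk>B \<subset> X; \<And>x y. \<lbrakk>x \<in> B; y \<in> B\<rbrakk> \<Longrightarrow> f x y \<in> B; r \<in> B; c \<in> B; s \<in> B\<rbrakk>
    \<Longrightarrow> covered X f r c s"
| disjoint: "\<lbrakk>R \<subseteq> X; C \<subseteq> X; R \<inter> C = {}; card R = card C; card S = card R;
    \<And>x y. \<lbrakk>x \<in> R; y \<in> C\<rbrakk> \<Longrightarrow> f x y \<in> S; r \<in> R; c \<in> C; s \<in> S\<rbrakk>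
    \<Longrightarrow> covered X f r c s"

definition triple_covered :: "'a set \<Rightarrow> ('a \<Rightarrow> 'a \<Rightarrow> 'a) \<Rightarrow> bool" where
  "triple_covered X f \<longleftrightarrow> (\<forall>r\<in>X. \<forall>c\<in>X. \<forall>s\<in>X. covered X f r c s)"

definition covered_order :: "nat \<Rightarrow> bool" where
  "covered_order n \<longleftrightarrow> (\<exists>f. ci_quasigroup {1..n} f \<and> triple_covered {1..n} f)"

definition transport :: "('a \<Rightarrow> 'b) \<Rightarrow> 'a set \<Rightarrow> ('a \<Rightarrow> 'a \<Rightarrow> 'a) \<Rightarrow> 'b \<Rightarrow> 'b \<Rightarrow> 'b" where
  "transport \<phi> X f u v = \<phi> (f (inv_into X \<phi> u) (inv_into X \<phi> v))"

lemma transport_apply: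
  "\<lbrakk>inj_on \<phi> X; x \<in> X; y \<in> X\<rbrakk> \<Longrightarrow> transport \<phi> X f (\<phi> x) (\<phi> y) = \<phi> (f x y)"
  by (simp add: transport_def)

lemma (in ci_quasigroup) ci_quasigroup_transport:
  assumes inj: "inj_on \<phi> X"
  shows "ci_quasigroup (\<phi> ` X) (transport \<phi> X f)"
proof
  note apply_\<phi> = transport_apply[OF inj]
  show "finite (\<phi> ` X)" using finite_carrier by simp
  show "transport \<phi> X f u u = u" if "u \<in> \<phi> ` X" for u
    using that by (auto simp: apply_\<phi> idem)
  show "transport \<phi> X f u v \<in> \<phi> ` X" if "u \<in> \<phi> ` X" "v \<in> \<phi> ` X" for u v
    using that by (auto simp: apply_\<phi> closed)
  show "transport \<phi> X f u v = transport \<phi> X f v u" if "u \<in> \<phi> ` X" "v \<in> \<phi> ` X" for u v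
    using that by (auto simp: apply_\<phi> intro!: arg_cong[of _ _ \<phi>] comm)
  show "v = w"
    if "u \<in> \<phi> ` X" "v \<in> \<phi> ` X" "w \<in> \<phi> ` X" and eq: "transport \<phi> X f u v = transport \<phi> X f u w"
      for u v w
  proof -
    from that obtain x y z where xyz: "x \<in> X" "y \<in> X" "z \<in> X" "u = \<phi> x" "v = \<phi> y" "w = \<phi> z" by blast
    then have "f x y = f x z"
      using eq inj by (auto simp: apply_\<phi> closed dest: inj_onD)
    then show "v = w" using xyz cancel by blast
  qed
qed

lemma (in ci_quasigroup) covered_transport:
  assumes inj: "inj_on \<phi> X" and "covered X f r c s"
  shows "covered (\<phi> ` X) (transport \<phi> X f) (\<phi> r) (\<phi> c) (\<phi> s)"
  using assms(2)
proof cases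
  case (closed B)
  have "\<phi> ` B \<subset> \<phi> ` X"
    using closed(1) inj by (metis image_mono inj_on_image_eq_iff psubset_eq subset_refl)
  moreover have "transport \<phi> X f u v \<in> \<phi> ` B" if "u \<in> \<phi> ` B" "v \<in> \<phi> ` B" for u v
    using that closed(1,2) by (auto simp: transport_apply[OF inj] subset_iff psubset_eq)
  ultimately show ?thesis using closed(3-5) by (intro covered.closed[of "\<phi> ` B"]) auto
next
  case (disjoint R C S)
  have "bij_betw (f r) C S"
    using disjoint by (intro row_bij_betw) auto
  then have "S = f r ` C" by (simp add: bij_betw_imp_surj_on)
  then have "S \<subseteq> X" using disjoint(1,2,7) closed by blast
  show ?thesis
  proof (rule covered.disjoint)
    show "\<phi> ` R \<inter> \<phi> ` C = {}" using disjoint(1-3) inj by (metis image_empty inj_on_image_Int)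
    show "card (\<phi> ` R) = card (\<phi> ` C)" "card (\<phi> ` S) = card (\<phi> ` R)"
      using disjoint(1,2,4,5) \<open>S \<subseteq> X\<close> inj by (metis card_image inj_on_subset)+
    show "transport \<phi> X f u v \<in> \<phi> ` S" if "u \<in> \<phi> ` R" "v \<in> \<phi> ` C" for u v
      using that disjoint(1,2,6) by (auto simp: transport_apply[OF inj] subset_iff)
  qed (use disjoint in auto)
qed

lemma covered_orderI:
  assumes "ci_quasigroup X f" "triple_covered X f"
  shows "covered_order (card X)"
proof -
  interpret ci_quasigroup X f by fact
  obtain \<phi> where \<phi>: "bij_betw \<phi> X {1..card X}"
    using finite_carrier finite_same_card_bij[of X "{1..card X}"] by auto
  then have inj: "inj_on \<phi> X" and img: "\<phi> ` X = {1..card X}" by (simp_all add: bij_betw_def)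
  have "triple_covered (\<phi> ` X) (transport \<phi> X f)"
    using assms(2) covered_transport[OF inj] by (auto simp: triple_covered_def)
  then show ?thesis
    using ci_quasigroup_transport[OF inj] unfolding covered_order_def img by blast
qed

lemma latin_subsquareI:
  assumes "ci_quasigroup {1..n} f" "R \<subseteq> {1..n}" "C \<subseteq> {1..n}" "card R = card C" "card S = card R"
    and S: "\<And>x y. \<lbrakk>x \<in> R; y \<in> C\<rbrakk> \<Longrightarrow> f x y \<in> S"
  shows "latin_subsquare n f R C S"
proof -
  interpret ci_quasigroup "{1..n}" f by fact
  have "finite R" "finite C" using assms(2,3) by (auto intro: finite_subset)
  then have "R \<noteq> {} \<longleftrightarrow> C \<noteq> {}" using assms(4) by (metis card_0_eq)
  then show ?thesis
    unfolding latin_subsquare_def using assms by (auto intro!: row_bij_betw col_bij_betw)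
qed

lemma covered_imp_proper_latin_subsquare:
  assumes "ci_quasigroup {1..n} f" "covered {1..n} f r c s"
  shows "\<exists>R C S. proper_latin_subsquare n f R C S \<and> r \<in> R \<and> c \<in> C \<and> s \<in> S"
  using assms(2)
proof cases
  case (closed B)
  then have "latin_subsquare n f B B B" by (intro latin_subsquareI[OF assms(1)]) auto
  then show ?thesis using closed unfolding proper_latin_subsquare_def by blast
next
  case (disjoint R C S)
  then have "latin_subsquare n f R C S" by (intro latin_subsquareI[OF assms(1)])
  moreover have "\<not> (R = {1..n} \<and> C = {1..n})" using disjoint by blast
  ultimately show ?thesis using disjoint unfolding proper_latin_subsquare_def by blast
qed

lemma ci_quasigroup_imp_latin_square:
  assumes "ci_quasigroup {1..n} f"
  shows "latin_square n f" "symmetric_ls n f" "idempotent_ls n f"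
proof -
  interpret ci_quasigroup "{1..n}" f by fact
  have "latin_subsquare n f {1..n} {1..n} {1..n}"
    using closed by (intro latin_subsquareI[OF assms]) auto
  then show "latin_square n f" unfolding latin_square_def latin_subsquare_def by blast
  show "symmetric_ls n f" using comm by (simp add: symmetric_ls_def)
  show "idempotent_ls n f" using idem by (simp add: idempotent_ls_def)
qed

section \<open>Frames\<close>

locale frame =
  fixes P :: "'p set" and grp :: "'p \<Rightarrow> 'g" and h :: "'p \<Rightarrow> 'p \<Rightarrow> 'p"
  assumes finite_points: "finite P" and points_nonempty: "P \<noteq> {}"
    and h_closed: "\<lbrakk>x \<in> P; y \<in> P; grp x \<noteq> grp y\<rbrakk> \<Longrightarrow> h x y \<in> P"
    and h_group: "\<lbrakk>x \<in> P; y \<in> P; grp x \<noteq> grp y\<rbrakk> \<Longrightarrow> grp (h x y) \<noteq> grp x"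
    and h_comm: "\<lbrakk>x \<in> P; y \<in> P; grp x \<noteq> grp y\<rbrakk> \<Longrightarrow> h x y = h y x"
    and h_cancel: "\<lbrakk>x \<in> P; y \<in> P; z \<in> P; grp x \<noteq> grp y; grp x \<noteq> grp z; h x y = h x z\<rbrakk> \<Longrightarrow> y = z"
begin

lemma h_solvable:
  assumes "x \<in> P" "z \<in> P" "grp z \<noteq> grp x"
  obtains y where "y \<in> P" "grp x \<noteq> grp y" "h x y = z"
proof -
  define A where "A = {y \<in> P. grp x \<noteq> grp y}"
  have "finite A" using finite_points by (simp add: A_def)
  moreover have "h x ` A \<subseteq> A"
  proof (rule image_subsetI)
    fix y assume "y \<in> A"
    then show "h x y \<in> A" using h_closed[of x y] h_group[of x y] assms(1) by (simp add: A_def)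
  qed
  moreover have "inj_on (h x) A"
  proof (rule inj_onI)
    fix y y' assume "y \<in> A" "y' \<in> A" "h x y = h x y'"
    then show "y = y'" using h_cancel[of x y y'] assms(1) by (simp add: A_def)
  qed
  ultimately have "h x ` A = A" by (rule endo_inj_surj)
  moreover have "z \<in> A" using assms by (simp add: A_def)
  ultimately obtain y where "y \<in> A" "h x y = z" by (metis imageE)
  then show thesis using that by (auto simp: A_def)
qed

definition flat :: "'p set \<Rightarrow> bool" where
  "flat B \<longleftrightarrow> B \<subset> P \<and> (\<forall>x\<in>B. \<forall>y\<in>P. grp x = grp y \<longrightarrow> y \<in> B) \<and>
     (\<forall>x\<in>B. \<forall>y\<in>B. grp x \<noteq> grp y \<longrightarrow> h x y \<in> B)"

inductive frame_covered :: "'p \<Rightarrow> 'p \<Rightarrow> 'p \<Rightarrow> bool" for r c s where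
  flat: "\<lbrakk>flat B; r \<in> B; c \<in> B; s \<in> B\<rbrakk> \<Longrightarrow> frame_covered r c s"
| disjoint: "\<lbrakk>R \<subseteq> P; C \<subseteq> P; grp ` R \<inter> grp ` C = {}; card R = card C; card S = card R;
    \<And>x y. \<lbrakk>x \<in> R; y \<in> C\<rbrakk> \<Longrightarrow> h x y \<in> S; r \<in> R; c \<in> C; s \<in> S\<rbrakk>
    \<Longrightarrow> frame_covered r c s"

lemma frame_covered_imp_flat:
  assumes "frame_covered x x y"
  obtains B where "flat B" "x \<in> B" "y \<in> B"
  using assms by cases (use that in blast)+

end

locale filled_frame = frame P grp h
  for P :: "'p set" and grp :: "'p \<Rightarrow> 'g" and h :: "'p \<Rightarrow> 'p \<Rightarrow> 'p" +
  fixes W :: "'w set" and Q :: "'g \<Rightarrow> 'p + 'w \<Rightarrow> 'p + 'w \<Rightarrow> 'p + 'w" and w_op :: "'w \<Rightarrow> 'w \<Rightarrow> 'w"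
  assumes filling: "x \<in> P \<Longrightarrow> ci_quasigroup ({y \<in> P. grp y = grp x} <+> W) (Q (grp x))"
    and Q_Inr_Inr: "\<lbrakk>x \<in> P; i \<in> W; j \<in> W\<rbrakk> \<Longrightarrow> Q (grp x) (Inr i) (Inr j) = Inr (w_op i j)"
begin

abbreviation points :: "('p + 'w) set" where
  "points \<equiv> P <+> W"

abbreviation filled_group :: "'p \<Rightarrow> ('p + 'w) set" where
  "filled_group x \<equiv> {y \<in> P. grp y = grp x} <+> W"

fun fill :: "'p + 'w \<Rightarrow> 'p + 'w \<Rightarrow> 'p + 'w" where
  "fill (Inl x) (Inl y) = (if grp x = grp y then Q (grp x) (Inl x) (Inl y) else Inl (h x y))"
| "fill (Inl x) (Inr j) = Q (grp x) (Inl x) (Inr j)"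
| "fill (Inr i) (Inl y) = Q (grp y) (Inr i) (Inl y)"
| "fill (Inr i) (Inr j) = Inr (w_op i j)"

lemma fill_eq_Q:
  assumes "x \<in> P" "u \<in> filled_group x" "v \<in> filled_group x"
  shows "fill u v = Q (grp x) u v"
  using assms(2,3) by (elim PlusE) (auto simp: Q_Inr_Inr[OF assms(1)])

lemma ci_quasigroup_filled_group:
  assumes "x \<in> P"
  shows "ci_quasigroup (filled_group x) fill"
proof -
  interpret Q: ci_quasigroup "filled_group x" "Q (grp x)" using assms by (rule filling)
  note eq = fill_eq_Q[OF assms]
  show ?thesis
  proof
    show "finite (filled_group x)" by (rule Q.finite_carrier)
    show "fill u u = u" if "u \<in> filled_group x" for u
      using that by (simp add: eq Q.idem)
    show "fill u v \<in> filled_group x" if "u \<in> filled_group x" "v \<in> filled_group x" for u v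
      using Q.closed[OF that] by (simp only: eq[OF that])
    show "fill u v = fill v u" if "u \<in> filled_group x" "v \<in> filled_group x" for u v
      using Q.comm[OF that] by (simp only: eq[OF that] eq[OF that(2,1)])
    show "v = w" if "u \<in> filled_group x" "v \<in> filled_group x" "w \<in> filled_group x"
      and "fill u v = fill u w" for u v w
      using Q.cancel[OF that(1-3)] that(4) by (simp only: eq[OF that(1,2)] eq[OF that(1,3)])
  qed
qed

lemma filled_group_subset: "filled_group x \<subseteq> points"
  by auto

lemma filled_group_or_cross:
  assumes "u \<in> points" "v \<in> points"
  obtains (same) x where "x \<in> P" "u \<in> filled_group x" "v \<in> filled_group x"
  | (cross) x y where "x \<in> P" "y \<in> P" "u = Inl x" "v = Inl y" "grp x \<noteq> grp y"
proof -
  obtain x0 where "x0 \<in> P" using points_nonempty by blast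
  from assms consider (both) x y where "x \<in> P" "y \<in> P" "u = Inl x" "v = Inl y"
    | (left) x where "x \<in> P" "u = Inl x" "v \<in> Inr ` W"
    | (right) y where "y \<in> P" "v = Inl y" "u \<in> Inr ` W"
    | (neither) "u \<in> Inr ` W" "v \<in> Inr ` W" by blast
  then show thesis
  proof cases
    case (both x y)
    then show thesis using same[of x] cross[of x y] by (cases "grp x = grp y") auto
  next
    case (left x)
    then show thesis by (intro same[of x]) auto
  next
    case (right y)
    then show thesis by (intro same[of y]) auto
  next
    case neither
    then show thesis using \<open>x0 \<in> P\<close> by (intro same[of x0]) auto
  qed
qed

lemma finite_core: "finite W"
proof -
  obtain x where "x \<in> P" using points_nonempty by blast
  then show ?thesis using ci_quasigroup.finite_carrier[OF filling] by (auto simp: finite_Plus_iff)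
qed

lemma ci_quasigroup_fill: "ci_quasigroup points fill"
proof (rule ci_quasigroupI_solvable)
  show "finite points" using finite_points finite_core by simp
  fix u v assume uv: "u \<in> points" "v \<in> points"
  have product: "fill u v \<in> points \<and> fill u v = fill v u"
  proof (cases rule: filled_group_or_cross[OF uv, case_names same cross])
    case (same x)
    interpret ci_quasigroup "filled_group x" fill using same(1) by (rule ci_quasigroup_filled_group)
    show ?thesis
      using subsetD[OF filled_group_subset closed[OF same(2,3)]] comm[OF same(2,3)] by (rule conjI)
  next
    case (cross x y)
    then show ?thesis using h_closed[of x y] h_comm[of x y] by (simp add: InlI)
  qed
  show "fill u v \<in> points" using product by (rule conjunct1)
  show "fill u v = fill v u" using product by (rule conjunct2)
  show "\<exists>z\<in>points. fill u z = v"
  proof (cases rule: filled_group_or_cross[OF uv, case_names same cross])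
    case (same x)
    interpret ci_quasigroup "filled_group x" fill using same(1) by (rule ci_quasigroup_filled_group)
    obtain z where "z \<in> filled_group x" "fill u z = v" using same(2,3) by (rule solvable)
    then show ?thesis using filled_group_subset by blast
  next
    case (cross x y)
    obtain z where "z \<in> P" "grp x \<noteq> grp z" "h x z = y"
      using cross(1,2) cross(5)[symmetric]
      by (rule h_solvable)
    then have "fill u (Inl z) = v" using cross(3,4) by simp
    then show ?thesis using \<open>z \<in> P\<close> by blast
  qed
next
  fix u assume "u \<in> points"
  then obtain x where "x \<in> P" "u \<in> filled_group x"
    using filled_group_or_cross[of u u] by auto
  then show "fill u u = u" by (rule ci_quasigroup.idem[OF ci_quasigroup_filled_group])
qed

lemma fill_flat_closed:
  assumes "flat B" "u \<in> B <+> W" "v \<in> B <+> W"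
  shows "fill u v \<in> B <+> W"
proof -
  have "B \<subseteq> P" and saturated: "\<And>x y. \<lbrakk>x \<in> B; y \<in> P; grp x = grp y\<rbrakk> \<Longrightarrow> y \<in> B"
    and h: "\<And>x y. \<lbrakk>x \<in> B; y \<in> B; grp x \<noteq> grp y\<rbrakk> \<Longrightarrow> h x y \<in> B"
    using assms(1) unfolding flat_def by blast+
  have uv: "u \<in> points" "v \<in> points" using assms(2,3) \<open>B \<subseteq> P\<close> by auto
  show ?thesis
  proof (cases rule: filled_group_or_cross[OF uv, case_names same cross])
    case (same x)
    then have closed: "fill u v \<in> filled_group x"
      using ci_quasigroup.closed[OF ci_quasigroup_filled_group] by blast
    show ?thesis
    proof (cases "x \<in> B")
      case True
      then show ?thesis using closed saturated by auto
    next
      case False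
      then have "u \<in> Inr ` W" "v \<in> Inr ` W" using same assms(2,3) saturated \<open>B \<subseteq> P\<close> by auto
      then obtain i j where "i \<in> W" "j \<in> W" "u = Inr i" "v = Inr j" by blast
      then show ?thesis using closed by auto
    qed
  next
    case (cross x y)
    then have "x \<in> B" "y \<in> B" using assms(2,3) by auto
    then show ?thesis using h[of x y] cross by (simp add: InlI)
  qed
qed

lemma covered_fill_flat:
  assumes "flat B" "r \<in> B <+> W" "c \<in> B <+> W" "s \<in> B <+> W"
  shows "covered points fill r c s"
proof (rule covered.closed)
  show "B <+> W \<subset> points" using assms(1) by (auto simp: flat_def)
qed (use assms fill_flat_closed in auto)

lemma covered_fill_Inl:
  assumes "frame_covered x y z"
  shows "covered points fill (Inl x) (Inl y) (Inl z)"
  using assms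
proof cases
  case (flat B)
  then show ?thesis by (intro covered_fill_flat) auto
next
  case (disjoint R C S)
  have "fill u v \<in> Inl ` S" if uv: "u \<in> Inl ` R" "v \<in> Inl ` C" for u v
  proof -
    obtain x y where "u = Inl x" "v = Inl y" "x \<in> R" "y \<in> C" using uv by blast
    moreover from this have "grp x \<noteq> grp y" using disjoint(3) by blast
    ultimately show ?thesis using disjoint(6) by simp
  qed
  then show ?thesis
    using disjoint
    by (intro covered.disjoint[of "Inl ` R" _ "Inl ` C" "Inl ` S"]) (auto simp: card_image)
qed

lemma triple_covered_fill:
  assumes cov: "\<And>x y z. \<lbrakk>x \<in> P; y \<in> P; z \<in> P\<rbrakk> \<Longrightarrow> frame_covered x y z"
  shows "triple_covered points fill"
  unfolding triple_covered_def
proof (intro ballI)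
  fix r c s assume rcs: "r \<in> points" "c \<in> points" "s \<in> points"
  have by_pair: "covered points fill r c s"
    if xy: "x \<in> P" "y \<in> P" and rcs: "{r, c, s} \<subseteq> {x, y} <+> W" for x y
  proof -
    obtain B where "flat B" "x \<in> B" "y \<in> B"
      using cov[OF xy(1) xy] by (rule frame_covered_imp_flat)
    then show ?thesis using rcs by (intro covered_fill_flat) auto
  qed
  obtain x0 where "x0 \<in> P" using points_nonempty by blast
  then have pt: "\<exists>x\<in>P. u \<in> {x} <+> W" if "u \<in> points" for u
    using that by (cases u) auto
  obtain x y z where xyz: "x \<in> P" "y \<in> P" "z \<in> P"
    "r \<in> {x} <+> W" "c \<in> {y} <+> W" "s \<in> {z} <+> W"
    using pt[OF rcs(1)] pt[OF rcs(2)] pt[OF rcs(3)] by blast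
  consider (points) "r = Inl x" "c = Inl y" "s = Inl z"
    | (core_r) "r \<in> Inr ` W" | (core_c) "c \<in> Inr ` W" | (core_s) "s \<in> Inr ` W"
    using xyz by auto
  then show "covered points fill r c s"
  proof cases
    case points
    then show ?thesis using covered_fill_Inl[OF cov] xyz by simp
  next
    case core_r
    then show ?thesis using xyz by (intro by_pair[of y z]) auto
  next
    case core_c
    then show ?thesis using xyz by (intro by_pair[of x z]) auto
  next
    case core_s
    then show ?thesis using xyz by (intro by_pair[of x y]) auto
  qed
qed

lemma card_points: "card points = card P + card W"
  using finite_points finite_core by (rule card_Plus)

end

definition fillable :: "nat \<Rightarrow> nat \<Rightarrow> bool" where
  "fillable m w \<longleftrightarrow> (\<exists>q. ci_quasigroup ({0..<int m} <+> {..<w}) q \<and>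
     (\<forall>i<w. \<forall>j<w. q (Inr i) (Inr j) \<in> Inr ` {..<w}))"

lemma fillable_any_group:
  assumes "fillable m w"
  obtains w_op :: "nat \<Rightarrow> nat \<Rightarrow> nat"
  where "\<forall>G :: 'a set. finite G \<longrightarrow> card G = m \<longrightarrow> (\<exists>q. ci_quasigroup (G <+> {..<w}) q \<and>
    (\<forall>i<w. \<forall>j<w. q (Inr i) (Inr j) = Inr (w_op i j)))"
proof -
  let ?X = "{0..<int m} <+> {..<w}"
  obtain q where "ci_quasigroup ?X q" and W: "\<forall>i<w. \<forall>j<w. q (Inr i) (Inr j) \<in> Inr ` {..<w}"
    using assms unfolding fillable_def by blast
  then interpret ci_quasigroup ?X q by simp
  define w_op where "w_op i j = projr (q (Inr i) (Inr j))" for i j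
  have "\<exists>q'. ci_quasigroup (G <+> {..<w}) q' \<and> (\<forall>i<w. \<forall>j<w. q' (Inr i) (Inr j) = Inr (w_op i j))"
    if G: "finite G" "card G = m" for G :: "'a set"
  proof -
    obtain \<beta> where \<beta>: "bij_betw \<beta> {0..<int m} G"
      using finite_same_card_bij[of "{0..<int m}" G] G by auto
    define \<phi> :: "int + nat \<Rightarrow> 'a + nat" where "\<phi> = map_sum \<beta> id"
    have inj: "inj_on \<phi> ?X"
      by (rule inj_onI) (auto simp: \<phi>_def inj_on_eq_iff[OF bij_betw_imp_inj_on[OF \<beta>]])
    have img: "\<phi> ` ?X = G <+> {..<w}"
      unfolding \<phi>_def bij_betw_imp_surj_on[OF \<beta>, symmetric]
      by (auto simp: Plus_def image_Un image_image)
    have "transport \<phi> ?X q (Inr i) (Inr j) = Inr (w_op i j)" if "i < w" "j < w" for i j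
    proof -
      have "transport \<phi> ?X q (\<phi> (Inr i)) (\<phi> (Inr j)) = \<phi> (q (Inr i) (Inr j))"
        using that by (intro transport_apply[OF inj]) auto
      moreover have "q (Inr i) (Inr j) = Inr (w_op i j)"
        using W[rule_format, OF that] by (auto simp: w_op_def)
      ultimately show ?thesis by (simp add: \<phi>_def)
    qed
    then show ?thesis using ci_quasigroup_transport[OF inj] unfolding img by blast
  qed
  then show thesis using that by blast
qed

context frame begin

definition weighted :: "nat \<Rightarrow> 'p \<times> nat \<Rightarrow> 'p \<times> nat \<Rightarrow> 'p \<times> nat" where
  "weighted m u v = (h (fst u) (fst v), (snd u + snd v) mod m)"

lemma frame_weighted:
  assumes "0 < m"
  shows "frame (P \<times> {..<m}) (grp \<circ> fst) (weighted m)"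
proof
  show "finite (P \<times> {..<m})" "P \<times> {..<m} \<noteq> {}" using finite_points points_nonempty assms by auto
next
  fix u v assume uv: "u \<in> P \<times> {..<m}" "v \<in> P \<times> {..<m}" "(grp \<circ> fst) u \<noteq> (grp \<circ> fst) v"
  then show "weighted m u v \<in> P \<times> {..<m}"
    using h_closed assms by (auto simp: weighted_def)
  show "(grp \<circ> fst) (weighted m u v) \<noteq> (grp \<circ> fst) u"
    using uv h_group by (auto simp: weighted_def)
  show "weighted m u v = weighted m v u"
    using uv h_comm by (auto simp: weighted_def add.commute)
next
  fix u v v' assume u: "u \<in> P \<times> {..<m}" "v \<in> P \<times> {..<m}" "v' \<in> P \<times> {..<m}"
    "(grp \<circ> fst) u \<noteq> (grp \<circ> fst) v" "(grp \<circ> fst) u \<noteq> (grp \<circ> fst) v'"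
    and eq: "weighted m u v = weighted m u v'"
  have "fst v = fst v'"
    using h_cancel[of "fst u" "fst v" "fst v'"] u eq
    by (auto simp: weighted_def)
  moreover have "[snd v = snd v'] (mod m)"
    using eq by (simp add: weighted_def cong_add_lcancel_nat flip: cong_def)
  then have "snd v = snd v'" using u by (auto intro: cong_less_modulus_unique_nat)
  ultimately show "v = v'" by (simp add: prod_eq_iff)
qed

lemma frame_covered_weighted:
  assumes "0 < m" "frame_covered (fst u) (fst v) (fst z)"
    and u: "u \<in> P \<times> {..<m}" "v \<in> P \<times> {..<m}" "z \<in> P \<times> {..<m}"
  shows "frame.frame_covered (P \<times> {..<m}) (grp \<circ> fst) (weighted m) u v z"
proof -
  interpret w: frame "P \<times> {..<m}" "grp \<circ> fst" "weighted m" using assms(1) by (rule frame_weighted)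
  from assms(2) show ?thesis
  proof cases
    case (flat B)
    have "w.flat (B \<times> {..<m})"
      using flat(1) assms(1) unfolding flat_def w.flat_def by (fastforce simp: weighted_def)
    then show ?thesis by (rule w.frame_covered.flat) (use flat u in \<open>auto simp: mem_Times_iff\<close>)
  next
    case (disjoint R C S)
    show ?thesis
    proof (rule w.frame_covered.disjoint)
      show "card (R \<times> {..<m}) = card (C \<times> {..<m})" "card (S \<times> {..<m}) = card (R \<times> {..<m})"
        using disjoint by (simp_all add: card_cartesian_product)
      show "weighted m u v \<in> S \<times> {..<m}" if "u \<in> R \<times> {..<m}" "v \<in> C \<times> {..<m}" for u v
        using that disjoint(6) assms(1) by (auto simp: weighted_def)
      show "(grp \<circ> fst) ` (R \<times> {..<m}) \<inter> (grp \<circ> fst) ` (C \<times> {..<m}) = {}"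
        using disjoint(3) by fastforce
    qed (use disjoint u in \<open>auto simp: mem_Times_iff\<close>)
  qed
qed

theorem covered_order_weighted:
  assumes cov: "\<And>x y z. \<lbrakk>x \<in> P; y \<in> P; z \<in> P\<rbrakk> \<Longrightarrow> frame_covered x y z"
    and groups: "\<And>x. x \<in> P \<Longrightarrow> card {y \<in> P. grp y = grp x} = k"
    and fillable: "fillable (k * m) w" and "0 < m"
  shows "covered_order (card P * m + w)"
proof -
  interpret w: frame "P \<times> {..<m}" "grp \<circ> fst" "weighted m" using \<open>0 < m\<close> by (rule frame_weighted)
  let ?group = "\<lambda>\<gamma>. {u \<in> P \<times> {..<m}. (grp \<circ> fst) u = \<gamma>}"
  obtain w_op where w_op: "\<forall>G :: ('p \<times> nat) set. finite G \<longrightarrow> card G = k * m \<longrightarrow>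
      (\<exists>q. ci_quasigroup (G <+> {..<w}) q \<and> (\<forall>i<w. \<forall>j<w. q (Inr i) (Inr j) = Inr (w_op i j)))"
    using fillable by (rule fillable_any_group)
  have "\<exists>q. ci_quasigroup (?group (grp x) <+> {..<w}) q \<and>
      (\<forall>i<w. \<forall>j<w. q (Inr i) (Inr j) = Inr (w_op i j))" if "x \<in> P" for x
  proof (rule w_op[rule_format])
    have eq: "?group (grp x) = {y \<in> P. grp y = grp x} \<times> {..<m}" by auto
    show "finite (?group (grp x))" using finite_points by simp
    show "card (?group (grp x)) = k * m"
      unfolding eq card_cartesian_product using groups[OF that] by simp
  qed
  then have "\<forall>\<gamma>\<in>grp ` P. \<exists>q. ci_quasigroup (?group \<gamma> <+> {..<w}) q \<and>
      (\<forall>i<w. \<forall>j<w. q (Inr i) (Inr j) = Inr (w_op i j))" by blast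
  from bchoice[OF this] obtain Q where Q: "\<forall>\<gamma>\<in>grp ` P. ci_quasigroup (?group \<gamma> <+> {..<w}) (Q \<gamma>) \<and>
      (\<forall>i<w. \<forall>j<w. Q \<gamma> (Inr i) (Inr j) = Inr (w_op i j))" by blast
  interpret filled_frame "P \<times> {..<m}" "grp \<circ> fst" "weighted m" "{..<w}" Q w_op
    by (intro filled_frame.intro w.frame_axioms filled_frame_axioms.intro) (use Q in auto)
  have "triple_covered points fill"
    using cov frame_covered_weighted[OF \<open>0 < m\<close>]
    by (intro triple_covered_fill) (auto simp: mem_Times_iff)
  then have "covered_order (card points)" by (rule covered_orderI[OF ci_quasigroup_fill])
  then show ?thesis by (simp add: card_points card_cartesian_product)
qed

end

lemma covered_order_weight:
  assumes "covered_order t" "0 < t" "fillable m w" "0 < m"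
  shows "covered_order (t * m + w)"
proof -
  obtain f where "ci_quasigroup {1..t} f" and cov: "triple_covered {1..t} f"
    using assms(1) unfolding covered_order_def by blast
  then interpret f: ci_quasigroup "{1..t}" f by simp
  interpret frame "{1..t}" id f
  proof
    fix x y assume xy: "x \<in> {1..t}" "y \<in> {1..t}" "id x \<noteq> id y"
    show "f x y \<in> {1..t}" "f x y = f y x" using xy(1,2) by (fact f.closed f.comm)+
    show "id (f x y) \<noteq> id x" using f.cancel[of x y x] f.idem[of x] xy by auto
    show "y = z" if "z \<in> {1..t}" "f x y = f x z" for z
      using xy(1,2) that by (rule f.cancel)
  qed (use assms(2) in auto)
  have "frame_covered x y z" if "x \<in> {1..t}" "y \<in> {1..t}" "z \<in> {1..t}" for x y z
  proof -
    have "covered {1..t} f x y z" using cov that unfolding triple_covered_def by blast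
    then show ?thesis
    proof cases
      case (closed B)
      then have "flat B" unfolding flat_def by auto
      then show ?thesis using closed(3-5) by (rule frame_covered.flat)
    next
      case (disjoint R C S)
      then show ?thesis by (intro frame_covered.disjoint[of R C S]) simp_all
    qed
  qed
  moreover have "card {y \<in> {1..t}. id y = id x} = 1" if "x \<in> {1..t}" for x
  proof -
    have "{y \<in> {1..t}. id y = id x} = {x}" using that by auto
    then show ?thesis by simp
  qed
  ultimately have "covered_order (card {1..t} * m + w)"
    using assms(3,4) by (intro covered_order_weighted[where k = 1]) simp_all
  then show ?thesis by simp
qed

section \<open>Fillings from starters\<close>

text \<open>In a commutative idempotent quasigroup \<open>\<sigma> s\<close> exchanges the two factors of every product with
  value \<open>s\<close>.\<close>
locale involution_family =
  fixes X :: "'a set" and \<sigma> :: "'a \<Rightarrow> 'a \<Rightarrow> 'a"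
  assumes finite_carrier: "finite X"
    and \<sigma>_closed: "\<lbrakk>s \<in> X; x \<in> X\<rbrakk> \<Longrightarrow> \<sigma> s x \<in> X"
    and \<sigma>_involution: "\<lbrakk>s \<in> X; x \<in> X\<rbrakk> \<Longrightarrow> \<sigma> s (\<sigma> s x) = x"
    and \<sigma>_fixed: "s \<in> X \<Longrightarrow> \<sigma> s s = s"
    and \<sigma>_transitive: "\<lbrakk>x \<in> X; y \<in> X\<rbrakk> \<Longrightarrow> \<exists>s\<in>X. \<sigma> s x = y"
begin

definition product :: "'a \<Rightarrow> 'a \<Rightarrow> 'a" where
  "product x y = (THE s. s \<in> X \<and> \<sigma> s x = y)"

lemma product_eqI:
  assumes "s \<in> X" "x \<in> X" "\<sigma> s x = y"
  shows "product x y = s"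
proof -
  have "X \<subseteq> (\<lambda>s. \<sigma> s x) ` X" using \<sigma>_transitive assms(2) by (auto simp: image_iff)
  then have "inj_on (\<lambda>s. \<sigma> s x) X" using finite_carrier by (intro finite_surj_inj)
  then show ?thesis unfolding product_def using assms by (intro the_equality) (auto dest: inj_onD)
qed

lemma product_in_carrier:
  assumes "x \<in> X" "y \<in> X"
  shows "product x y \<in> X" "\<sigma> (product x y) x = y"
proof -
  obtain s where "s \<in> X" "\<sigma> s x = y" using \<sigma>_transitive assms by blast
  then show "product x y \<in> X" "\<sigma> (product x y) x = y" using product_eqI assms(1) by simp_all
qed

lemma ci_quasigroup_product: "ci_quasigroup X product"
proof
  show "product x x = x" if "x \<in> X" for x using that \<sigma>_fixed by (intro product_eqI)
  show "product x y \<in> X" if "x \<in> X" "y \<in> X" for x y using that by (rule product_in_carrier)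
  show "product x y = product y x" if "x \<in> X" "y \<in> X" for x y
    using product_in_carrier[OF that(2,1)] \<sigma>_involution[of "product y x" y] that
    by (intro product_eqI) simp_all
  show "y = z" if "x \<in> X" "y \<in> X" "z \<in> X" and eq: "product x y = product x z" for x y z
    using product_in_carrier(2)[OF that(1,2), unfolded eq] product_in_carrier(2)[OF that(1,3)]
    by (rule trans[OF sym])
qed (rule finite_carrier)

end

lemma involution_family_odd:
  fixes w :: nat
  assumes "odd w"
  shows "involution_family {..<w} (\<lambda>s x. nat ((2 * int s - int x) mod int w))"
proof
  have w: "0 < w" using assms by (rule odd_pos)
  show "nat ((2 * int s - int x) mod int w) \<in> {..<w}" for s x
    using w by (simp add: nat_less_iff)
  show "nat ((2 * int s - int (nat ((2 * int s - int x) mod int w))) mod int w) = x"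
    if "x \<in> {..<w}" for s x
    using that w by (simp add: mod_diff_right_eq)
  show "nat ((2 * int s - int s) mod int w) = s" if "s \<in> {..<w}" for s
    using that by simp
  show "\<exists>s\<in>{..<w}. nat ((2 * int s - int x) mod int w) = y" if "x \<in> {..<w}" "y \<in> {..<w}" for x y
  proof
    define h where "h = (w + 1) div 2"
    have "2 * int h = int w + 1" using assms by (auto simp: h_def elim!: oddE)
    then have "2 * (int (x + y) * int h) = int (x + y) * (int w + 1)" by (metis mult.left_commute)
    then have "2 * (int (x + y) * int h) - int x = int y + int (x + y) * int w"
      by (simp add: algebra_simps)
    then have "(2 * (int (x + y) * int h) - int x) mod int w = int y" using that by simp
    then show "nat ((2 * int ((x + y) * h mod w) - int x) mod int w) = y"
      by (metis mod_diff_left_eq mod_mult_right_eq nat_int of_nat_mod of_nat_mult)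
    show "(x + y) * h mod w \<in> {..<w}" using w by simp
  qed
qed simp

definition differences :: "nat \<Rightarrow> (int \<Rightarrow> int) \<Rightarrow> int set \<Rightarrow> int set" where
  "differences m \<tau> T = (\<lambda>t. (\<tau> t - t) mod int m) ` T"

locale starter =
  fixes m w :: nat and T :: "int set" and \<tau> :: "int \<Rightarrow> int" and \<mu> :: "nat \<Rightarrow> int \<Rightarrow> int"
    and \<nu> :: "nat \<Rightarrow> int" and \<rho> :: "nat \<Rightarrow> nat \<Rightarrow> nat"
  assumes T: "T \<subseteq> {1..<int m}"
    and \<tau>: "t \<in> T \<Longrightarrow> \<tau> t \<in> T \<and> \<tau> (\<tau> t) = t"
    and \<mu>: "\<lbrakk>i < w; x \<in> {0..<int m}\<rbrakk> \<Longrightarrow> \<mu> i x \<in> {0..<int m} \<and> \<mu> i (\<mu> i x) = x"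
    and cover: "\<lbrakk>x \<in> {0..<int m}; y \<in> {0..<int m}; x \<noteq> y\<rbrakk>
      \<Longrightarrow> (y - x) mod int m \<in> differences m \<tau> T \<or> (\<exists>i<w. \<mu> i x = y)"
    and \<nu>: "bij_betw \<nu> {..<w} ({1..<int m} - T)"
    and \<rho>: "involution_family {..<w} \<rho>"
begin

text \<open>The products with value \<open>s\<close> in the cyclic group are the translates by \<open>s\<close> of the pairs
  \<open>{t, \<tau> t}\<close>; the elements that no such pair meets are the \<open>s + \<nu> i\<close>, multiplied by \<open>i\<close>.
  The matchings \<open>\<mu> i\<close> take care of the remaining pairs.\<close>
fun exchange :: "int + nat \<Rightarrow> int + nat \<Rightarrow> int + nat" where
  "exchange (Inl s) (Inl x) = (let t = (x - s) mod int m in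
     if t = 0 then Inl s else if t \<in> T then Inl ((s + \<tau> t) mod int m)
     else Inr (the_inv_into {..<w} \<nu> t))"
| "exchange (Inl s) (Inr j) = Inl ((s + \<nu> j) mod int m)"
| "exchange (Inr i) (Inl x) = Inl (\<mu> i x)"
| "exchange (Inr i) (Inr j) = Inr (\<rho> i j)"

lemma exchange_pair:
  assumes "t \<in> T"
  shows "exchange (Inl s) (Inl ((s + t) mod int m)) = Inl ((s + \<tau> t) mod int m)"
proof -
  have "((s + t) mod int m - s) mod int m = t" using assms T by (auto simp: mod_diff_left_eq)
  then show ?thesis using assms T by auto
qed

lemma exchange_single:
  assumes "j < w"
  shows "exchange (Inl s) (Inl ((s + \<nu> j) mod int m)) = Inr j"
proof -
  have "\<nu> j \<in> {1..<int m} - T" using \<nu> assms by (auto dest: bij_betwE)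
  moreover from this have "((s + \<nu> j) mod int m - s) mod int m = \<nu> j"
    by (simp add: mod_diff_left_eq)
  ultimately show ?thesis
    using assms by (simp add: the_inv_into_f_f[OF bij_betw_imp_inj_on[OF \<nu>]])
qed

lemma residue_cases:
  assumes "x \<in> {0..<int m}" "s \<in> {0..<int m}"
  obtains (self) "x = s" | (pair) t where "t \<in> T" "x = (s + t) mod int m"
  | (single) j where "j < w" "x = (s + \<nu> j) mod int m"
proof -
  define t where "t = (x - s) mod int m"
  have x: "x = (s + t) mod int m" using assms by (simp add: t_def mod_add_right_eq)
  have "t \<in> {0..<int m}" using assms by (simp add: t_def)
  then consider (zero) "t = 0" | (starter) "t \<in> T" | (rest) "t \<in> {1..<int m} - T" by fastforce
  then show thesis
  proof cases
    case zero
    then show thesis using self x assms by simp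
  next
    case starter
    then show thesis using pair x by simp
  next
    case rest
    then obtain j where "j < w" "t = \<nu> j" using bij_betw_imp_surj_on[OF \<nu>] by blast
    then show thesis using single x by simp
  qed
qed

abbreviation carrier :: "(int + nat) set" where
  "carrier \<equiv> {0..<int m} <+> {..<w}"

lemma exchange_Inl_involution:
  assumes s: "s \<in> {0..<int m}" and v: "v \<in> carrier"
  shows "exchange (Inl s) v \<in> carrier \<and> exchange (Inl s) (exchange (Inl s) v) = v"
proof (cases v)
  case (Inl x)
  with v have "x \<in> {0..<int m}" by auto
  then show ?thesis
    using s
  proof (cases rule: residue_cases)
    case self
    then show ?thesis using v Inl by simp
  next
    case (pair t)
    then show ?thesis using Inl s \<tau>[of t] by (simp add: exchange_pair InlI del: exchange.simps(1))
  next
    case (single j)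
    then show ?thesis using Inl s by (simp add: exchange_single InrI del: exchange.simps(1))
  qed
next
  case (Inr j)
  with v have "j < w" by auto
  then show ?thesis using Inr s by (simp add: exchange_single InlI del: exchange.simps(1))
qed

lemma exchange_transitive_residues:
  assumes "x \<in> {0..<int m}" "y \<in> {0..<int m}"
  shows "\<exists>z\<in>carrier. exchange z (Inl x) = Inl y"
proof -
  consider (equal) "x = y"
    | (pair) t where "t \<in> T" "(\<tau> t - t) mod int m = (y - x) mod int m"
    | (matching) i where "i < w" "\<mu> i x = y"
    using cover[OF assms] by (force simp: differences_def)
  then show ?thesis
  proof cases
    case equal
    then show ?thesis using assms by (intro bexI[of _ "Inl x"]) auto
  next
    case (pair t)
    define s where "s = (x - t) mod int m"
    have "(s + t) mod int m = x" using assms(1) by (simp add: s_def mod_add_left_eq)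
    moreover have "(s + \<tau> t) mod int m = (x + (\<tau> t - t) mod int m) mod int m"
      by (simp add: s_def mod_add_left_eq mod_add_right_eq algebra_simps)
    then have "(s + \<tau> t) mod int m = y" using pair(2) assms(2) by (simp add: mod_add_right_eq)
    moreover have "s \<in> {0..<int m}" using assms(1) by (simp add: s_def)
    ultimately show ?thesis using exchange_pair[OF pair(1), of s] by (intro bexI[of _ "Inl s"]) auto
  next
    case (matching i)
    then show ?thesis by (intro bexI[of _ "Inr i"]) auto
  qed
qed

lemma exchange_transitive_mixed:
  assumes "x \<in> {0..<int m}" "j < w"
  shows "\<exists>z\<in>carrier. exchange z (Inl x) = Inr j \<and> exchange z (Inr j) = Inl x"
proof -
  define s where "s = (x - \<nu> j) mod int m"
  have "s \<in> {0..<int m}" using assms(1) by (simp add: s_def)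
  moreover have "(s + \<nu> j) mod int m = x" using assms(1) by (simp add: s_def mod_add_left_eq)
  ultimately show ?thesis
    using exchange_single[OF assms(2), of s] by (intro bexI[of _ "Inl s"]) auto
qed

lemma exchange_transitive:
  assumes "u \<in> carrier" "v \<in> carrier"
  shows "\<exists>z\<in>carrier. exchange z u = v"
proof (cases u; cases v)
  fix x y assume "u = Inl x" "v = Inl y"
  then show ?thesis using assms exchange_transitive_residues by auto
next
  fix x j assume "u = Inl x" "v = Inr j"
  then show ?thesis using assms exchange_transitive_mixed[of x j] by auto
next
  fix j x assume "u = Inr j" "v = Inl x"
  then show ?thesis using assms exchange_transitive_mixed[of x j] by auto
next
  fix i j assume uv: "u = Inr i" "v = Inr j"
  then obtain k where "k < w" "\<rho> k i = j"
    using involution_family.\<sigma>_transitive[OF \<rho>, of i j] assms by auto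
  then show ?thesis using uv by (intro bexI[of _ "Inr k"]) auto
qed

sublocale involution_family carrier exchange
proof
  interpret \<rho>: involution_family "{..<w}" \<rho> by (rule \<rho>)
  have inv: "exchange u v \<in> carrier \<and> exchange u (exchange u v) = v"
    if "u \<in> carrier" "v \<in> carrier" for u v
  proof (cases u)
    case (Inl s)
    then have "s \<in> {0..<int m}" using that(1) by auto
    then show ?thesis unfolding Inl using that(2) by (rule exchange_Inl_involution)
  next
    case (Inr i)
    then have "i < w" using that(1) by auto
    then show ?thesis
      using that(2) Inr \<mu> \<rho>.\<sigma>_closed \<rho>.\<sigma>_involution by (cases v) auto
  qed
  show "exchange u v \<in> carrier" "exchange u (exchange u v) = v"
    if "u \<in> carrier" "v \<in> carrier" for u v
    using inv[OF that] by simp_all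
  show "exchange u u = u" if "u \<in> carrier" for u
    using that \<rho>.\<sigma>_fixed by (cases u) auto
  show "\<exists>s\<in>carrier. exchange s u = v" if "u \<in> carrier" "v \<in> carrier" for u v
    using that by (rule exchange_transitive)
qed simp

lemma fillable: "fillable m w"
proof -
  interpret \<rho>: involution_family "{..<w}" \<rho> by (rule \<rho>)
  have "product (Inr i) (Inr j) \<in> Inr ` {..<w}" if ij: "i < w" "j < w" for i j
  proof -
    obtain k where "k < w" "\<rho> k i = j" using \<rho>.\<sigma>_transitive[of i j] ij by auto
    then have "product (Inr i) (Inr j) = Inr k" using ij by (intro product_eqI) auto
    then show ?thesis using \<open>k < w\<close> by simp
  qed
  then show ?thesis using ci_quasigroup_product unfolding fillable_def by blast
qed

end

lemma fillable_starter:
  assumes w: "odd w \<or> w = 0" "card T + w + 1 = m" and T: "T \<subseteq> {1..<int m}"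
    and \<tau>: "\<And>t. t \<in> T \<Longrightarrow> \<tau> t \<in> T \<and> \<tau> (\<tau> t) = t"
    and \<mu>: "\<And>i x. \<lbrakk>i < w; x \<in> {0..<int m}\<rbrakk> \<Longrightarrow> \<mu> i x \<in> {0..<int m} \<and> \<mu> i (\<mu> i x) = x"
    and cover: "\<And>x y. \<lbrakk>x \<in> {0..<int m}; y \<in> {0..<int m}; x \<noteq> y\<rbrakk>
      \<Longrightarrow> (y - x) mod int m \<in> differences m \<tau> T \<or> (\<exists>i<w. \<mu> i x = y)"
  shows "fillable m w"
proof -
  have "finite T" using T finite_subset by blast
  then have "card ({1..<int m} - T) = w" using T w(2) by (simp add: card_Diff_subset)
  then obtain \<nu> where \<nu>: "bij_betw \<nu> {..<w} ({1..<int m} - T)"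
    using finite_same_card_bij[of "{..<w}" "{1..<int m} - T"] by auto
  have "\<exists>\<rho>. involution_family {..<w} \<rho>"
  proof (cases "w = 0")
    case True
    then show ?thesis by (auto simp: involution_family_def)
  qed (use w(1) involution_family_odd in blast)
  then obtain \<rho> where "involution_family {..<w} \<rho>" ..
  with T \<tau> \<mu> cover \<nu> interpret starter m w T \<tau> \<mu> \<nu> \<rho> by (rule starter.intro)
  show ?thesis by (rule fillable)
qed

lemma diff_mod_nonzero:
  fixes x y m :: int
  assumes "x \<in> {0..<m}" "y \<in> {0..<m}" "x \<noteq> y"
  shows "(y - x) mod m \<in> {1..<m}"
proof -
  have "(y - x) mod m \<noteq> 0"
  proof
    assume "(y - x) mod m = 0"
    then have "y mod m = x mod m" by (simp add: mod_eq_dvd_iff mod_eq_0_iff_dvd)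
    then show False using assms by simp
  qed
  moreover have "0 \<le> (y - x) mod m" "(y - x) mod m < m" using assms(1) by simp_all
  ultimately show ?thesis by simp
qed

lemma fillable_odd_0:
  assumes "odd m"
  shows "fillable m 0"
proof (rule fillable_starter[where T = "{1..<int m}" and \<tau> = "\<lambda>t. int m - t" and \<mu> = "\<lambda>_. id"])
  show "card {1..<int m} + 0 + 1 = m" using odd_pos[OF assms] by simp
  fix x y assume xy: "x \<in> {0..<int m}" "y \<in> {0..<int m}" "x \<noteq> y"
  obtain k where "m = 2 * k + 1" using assms by (elim oddE)
  define h where "h = int k + 1"
  have h: "2 * h = int m + 1" using \<open>m = 2 * k + 1\<close> by (simp add: h_def)
  define t where "t = (x - y) * h mod int m"
  define q where "q = (x - y) * h div int m"
  have "t = (x - y) * h - q * int m" unfolding t_def q_def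
    by (rule minus_div_mult_eq_mod[symmetric])
  moreover have "2 * ((x - y) * h) = (x - y) * (int m + 1)" using h by (metis mult.left_commute)
  ultimately have "int m - t - t = (y - x) + (1 - (x - y) + 2 * q) * int m"
    by (simp add: algebra_simps)
  then have t: "(int m - t - t) mod int m = (y - x) mod int m" by (simp only: mod_mult_self1)
  have "t \<noteq> 0" using t diff_mod_nonzero[OF xy] by auto
  moreover have "0 \<le> t" "t < int m" using xy(1) by (simp_all add: t_def)
  ultimately have "t \<in> {1..<int m}" by simp
  with t have "(y - x) mod int m \<in> differences m (\<lambda>t. int m - t) {1..<int m}"
    unfolding differences_def by (intro image_eqI[of _ _ t]) simp_all
  then show "(y - x) mod int m \<in> differences m (\<lambda>t. int m - t) {1..<int m} \<or> (\<exists>i<0. id x = y)" ..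
qed auto

lemma even_mod_of_nat_iff: "even m \<Longrightarrow> even (a mod int m) \<longleftrightarrow> even a"
  by (metis dvd_mod_iff even_of_nat)

definition alternating_shift :: "nat \<Rightarrow> int \<Rightarrow> int \<Rightarrow> int" where
  "alternating_shift m d x = (if even x \<or> even d then x + d else x - d) mod int m"

lemma alternating_shift_involution:
  assumes "even m" "odd d \<or> 2 * d = int m" "x \<in> {0..<int m}"
  shows "alternating_shift m d x \<in> {0..<int m} \<and>
    alternating_shift m d (alternating_shift m d x) = x"
proof (cases "even d")
  case True
  then have "x + d + d = x + int m" using assms(2) by simp
  then show ?thesis using True assms(3) by (simp add: alternating_shift_def mod_simps)
next
  case False
  then show ?thesis
    using assms(1,3) by (simp add: alternating_shift_def mod_simps even_mod_of_nat_iff)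
qed

lemma ex_alternating_shift:
  assumes "even m" "x \<in> {0..<int m}" "y \<in> {0..<int m}"
  obtains d where "d \<in> {(y - x) mod int m, (x - y) mod int m}" "alternating_shift m d x = y"
proof (cases "even x \<or> even ((y - x) mod int m)")
  case True
  then have "alternating_shift m ((y - x) mod int m) x = y"
    using assms(2,3) by (simp add: alternating_shift_def mod_add_right_eq)
  then show thesis by (rule that[rotated]) simp
next
  case False
  then have "alternating_shift m ((x - y) mod int m) x = y"
    using assms by (simp add: alternating_shift_def mod_diff_right_eq even_mod_of_nat_iff)
  then show thesis by (rule that[rotated]) simp
qed

lemma differences_subset:
  assumes "T \<subseteq> {1..<int m}" "\<And>t. t \<in> T \<Longrightarrow> \<tau> t \<in> T \<and> \<tau> t \<noteq> t"
  shows "differences m \<tau> T \<subseteq> {1..<int m}"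
  unfolding differences_def
proof (rule image_subsetI)
  fix t assume "t \<in> T"
  then have "\<tau> t \<in> T" "\<tau> t \<noteq> t" using assms(2) by simp_all
  then show "(\<tau> t - t) mod int m \<in> {1..<int m}"
    using assms(1) \<open>t \<in> T\<close> by (intro diff_mod_nonzero) auto
qed

lemma differences_uminus:
  assumes "\<And>t. t \<in> T \<Longrightarrow> \<tau> t \<in> T \<and> \<tau> (\<tau> t) = t" "(x - y) mod int m \<in> differences m \<tau> T"
  shows "(y - x) mod int m \<in> differences m \<tau> T"
proof -
  from assms(2) obtain t where t: "t \<in> T" "(\<tau> t - t) mod int m = (x - y) mod int m"
    unfolding differences_def by (elim imageE) simp
  then have "(\<tau> (\<tau> t) - \<tau> t) mod int m = (y - x) mod int m"
    using assms(1)[OF t(1)] mod_minus_cong[OF t(2)] by simp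
  then show ?thesis
    unfolding differences_def using assms(1)[OF t(1)] by (intro image_eqI[of _ _ "\<tau> t"]) simp_all
qed

lemma fillable_odd_differences:
  assumes w: "odd w" "card T + w + 1 = m" and "even m" and T: "T \<subseteq> {1..<int m}"
    and \<tau>: "\<And>t. t \<in> T \<Longrightarrow> \<tau> t \<in> T \<and> \<tau> (\<tau> t) = t \<and> \<tau> t \<noteq> t"
    and inj: "inj_on (\<lambda>t. (\<tau> t - t) mod int m) T"
    and rest: "\<And>d. d \<in> {1..<int m} - differences m \<tau> T \<Longrightarrow> odd d \<or> 2 * d = int m"
  shows "fillable m w"
proof -
  let ?rest = "{1..<int m} - differences m \<tau> T"
  have "differences m \<tau> T \<subseteq> {1..<int m}" using T \<tau> by (intro differences_subset) auto
  moreover have "card (differences m \<tau> T) = card T"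
    unfolding differences_def using inj by (rule card_image)
  ultimately have "card ?rest = w" using w(2) by (simp add: card_Diff_subset finite_subset)
  then obtain \<beta> where \<beta>: "bij_betw \<beta> {..<w} ?rest"
    using finite_same_card_bij[of "{..<w}" ?rest] by auto
  show ?thesis
  proof (rule fillable_starter[OF _ w(2) T, where \<mu> = "\<lambda>i. alternating_shift m (\<beta> i)"])
    show "\<tau> t \<in> T \<and> \<tau> (\<tau> t) = t" if "t \<in> T" for t using \<tau>[OF that] by simp
    show "alternating_shift m (\<beta> i) x \<in> {0..<int m} \<and>
        alternating_shift m (\<beta> i) (alternating_shift m (\<beta> i) x) = x"
      if "i < w" "x \<in> {0..<int m}" for i x
      using bij_betw_apply[OF \<beta>, of i] that \<open>even m\<close>
      by (intro alternating_shift_involution rest) simp_all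
    show "(y - x) mod int m \<in> differences m \<tau> T \<or> (\<exists>i<w. alternating_shift m (\<beta> i) x = y)"
      if x: "x \<in> {0..<int m}" and y: "y \<in> {0..<int m}" and "x \<noteq> y" for x y
    proof (cases "(y - x) mod int m \<in> differences m \<tau> T")
      case True
      then show ?thesis ..
    next
      case False
      then have "(x - y) mod int m \<notin> differences m \<tau> T" using \<tau> differences_uminus by blast
      then have "{(y - x) mod int m, (x - y) mod int m} \<subseteq> ?rest"
        using False diff_mod_nonzero[OF x y] diff_mod_nonzero[OF y x] \<open>x \<noteq> y\<close> by simp
      moreover obtain d where d: "d \<in> {(y - x) mod int m, (x - y) mod int m}"
          "alternating_shift m d x = y"
        using \<open>even m\<close> x y by (rule ex_alternating_shift)
      ultimately have "d \<in> ?rest" by blast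
      then obtain i where "i < w" "\<beta> i = d"
        using bij_betw_imp_surj_on[OF \<beta>] by (metis imageE lessThan_iff)
      then show ?thesis using d(2) by blast
    qed
  qed (use w(1) in simp)
qed

text \<open>The pairs \<open>{t, -t}\<close> of \<open>outer\<close> have all even differences except 0 and possibly \<open>k\<close>, the pairs
  \<open>{t, 1 - t}\<close> of \<open>inner\<close> have \<open>2 b\<close> different odd differences.\<close>
locale even_starter =
  fixes k :: nat and a b :: int
  assumes a_bounds: "0 \<le> a" "2 * a \<le> int k - 1" "int k - 2 \<le> 2 * a"
    and b_bounds: "0 \<le> b" "a + b \<le> int k - 1" "2 * b \<le> int k"
begin

definition outer :: "int set" where
  "outer = {1..a} \<union> {2 * int k - a..2 * int k - 1}"

definition inner :: "int set" where
  "inner = {int k + 1 - b..int k + b}"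

definition partner :: "int \<Rightarrow> int" where
  "partner t = (if t \<in> inner then 2 * int k + 1 - t else 2 * int k - t)"

lemma outer_inner_disjoint: "outer \<inter> inner = {}"
  unfolding outer_def inner_def using a_bounds b_bounds by auto

lemma starter_subset: "outer \<union> inner \<subseteq> {1..<2 * int k}"
  unfolding outer_def inner_def using a_bounds b_bounds by auto

lemma card_starter: "card (outer \<union> inner) = nat (2 * a + 2 * b)"
proof -
  have "card outer = nat a + nat a"
    unfolding outer_def using a_bounds by (subst card_Un_disjoint) auto
  moreover have "card inner = nat (2 * b)" by (simp add: inner_def)
  moreover have "finite outer" "finite inner" by (simp_all add: outer_def inner_def)
  ultimately show ?thesis
    using outer_inner_disjoint a_bounds(1) b_bounds(1)
    by (simp add: card_Un_disjoint)
qed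

lemma partner:
  assumes "t \<in> outer \<union> inner"
  shows "partner t \<in> outer \<union> inner \<and> partner (partner t) = t \<and> partner t \<noteq> t"
proof (cases "t \<in> inner")
  case True
  then have "2 * int k + 1 - t \<in> inner" by (auto simp: inner_def)
  moreover have "2 * int k + 1 - t \<noteq> t" by presburger
  ultimately show ?thesis using True by (simp add: partner_def)
next
  case False
  then have "t \<in> outer" using assms by simp
  then have "2 * int k - t \<in> outer" "2 * int k - t \<noteq> t" using a_bounds by (auto simp: outer_def)
  then show ?thesis using False outer_inner_disjoint by (auto simp: partner_def)
qed

lemma inj_on_difference: "inj_on (\<lambda>t. (partner t - t) mod (2 * int k)) (outer \<union> inner)"
proof (rule inj_onI)
  fix s t assume st: "s \<in> outer \<union> inner" "t \<in> outer \<union> inner"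
    and "(partner s - s) mod (2 * int k) = (partner t - t) mod (2 * int k)"
  then have dvd: "2 * int k dvd (partner s - s) - (partner t - t)" by (simp add: mod_eq_dvd_iff)
  then have "even ((partner s - s) - (partner t - t))" by (rule dvd_trans[rotated]) simp
  then have same: "s \<in> inner \<longleftrightarrow> t \<in> inner" by (auto simp: partner_def split: if_splits)
  then have "(partner s - s) - (partner t - t) = 2 * (t - s)" by (auto simp: partner_def)
  then have "2 * int k dvd 2 * (t - s)" using dvd by (simp only:)
  then have "int k dvd t - s" by (simp only: dvd_mult_cancel_left) simp
  then obtain j where j: "t - s = int k * j" ..
  have "\<bar>t - s\<bar> < int k * 2" using st a_bounds b_bounds unfolding outer_def inner_def by auto
  then have "int k * \<bar>j\<bar> < int k * 2" unfolding j by (simp add: abs_mult)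
  then have "\<bar>j\<bar> < 2" by (rule mult_left_less_imp_less) simp
  then have "j = 0 \<or> j = 1 \<or> j = -1" by linarith
  then have "t = s \<or> t = s + int k \<or> s = t + int k" using j by auto
  then show "s = t" using st same a_bounds b_bounds unfolding outer_def inner_def by auto
qed

lemma even_difference:
  assumes "1 \<le> e" "e < int k" "2 * e \<noteq> int k"
  shows "\<exists>t\<in>outer \<union> inner. (partner t - t) mod (2 * int k) = 2 * e"
proof -
  have partner_outer: "partner t = 2 * int k - t" if "t \<in> outer" for t
    using that outer_inner_disjoint by (auto simp: partner_def)
  show ?thesis
  proof (cases "e \<le> a")
    case True
    define t where "t = 2 * int k - e"
    have "t \<in> outer" using True assms(1) by (simp add: t_def outer_def)
    moreover from this have "partner t - t = 2 * e + (- 1) * (2 * int k)"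
      by (simp add: partner_outer t_def)
    then have "(partner t - t) mod (2 * int k) = 2 * e"
      using assms by (simp only: mod_mult_self1) simp
    ultimately show ?thesis by blast
  next
    case False
    define t where "t = int k - e"
    have "t \<in> outer" using False assms a_bounds by (auto simp: t_def outer_def)
    moreover from this have "(partner t - t) mod (2 * int k) = 2 * e"
      using assms by (simp add: partner_outer t_def)
    ultimately show ?thesis by blast
  qed
qed

end

lemma fillable_even:
  assumes w: "odd w" "w + 2 * ((k - 1) div 2) < 2 * k"
  shows "fillable (2 * k) w"
proof -
  define a where "a = (int k - 1) div 2"
  define b where "b = (2 * int k - 1 - 2 * a - int w) div 2"
  have "0 < k" using w(2) by (cases k) auto
  then have a_bounds: "0 \<le> a" "2 * a \<le> int k - 1" "int k - 2 \<le> 2 * a" unfolding a_def by linarith+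
  have "int ((k - 1) div 2) = a" using \<open>0 < k\<close> unfolding a_def by (simp add: zdiv_int of_nat_diff)
  then have "int w + 2 * a < 2 * int k" using w(2) by linarith
  moreover have "even (2 * int k - 1 - 2 * a - int w)" using w(1) by simp
  ultimately have b_eq: "2 * b = 2 * int k - 1 - 2 * a - int w" "0 \<le> b" unfolding b_def by auto
  interpret even_starter k a b
    using a_bounds b_eq odd_pos[OF w(1)] by unfold_locales linarith+
  have k2: "int (2 * k) = 2 * int k" by simp
  show ?thesis
  proof (rule fillable_odd_differences)
    show "card (outer \<union> inner) + w + 1 = 2 * k"
      unfolding card_starter using a_bounds b_eq by linarith
    show "odd d \<or> 2 * d = int (2 * k)"
      if d: "d \<in> {1..<int (2 * k)} - differences (2 * k) partner (outer \<union> inner)" for d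
    proof (rule ccontr)
      assume "\<not> (odd d \<or> 2 * d = int (2 * k))"
      then obtain e where e: "d = 2 * e" "2 * e \<noteq> int k" by (auto elim!: evenE)
      then obtain t where "t \<in> outer \<union> inner" "(partner t - t) mod (2 * int k) = d"
        using even_difference[of e] d by force
      then show False using d unfolding differences_def k2 by blast
    qed
  qed (use w(1) starter_subset partner inj_on_difference in simp_all)
qed

lemma fillable_6_5: "fillable 6 5"
proof -
  define \<mu> :: "nat \<Rightarrow> int \<Rightarrow> int" where
    "\<mu> i x = (if x = 5 then int i else if x = int i then 5 else (2 * int i - x) mod 5)" for i x
  have involution: "\<forall>i\<in>set [0..<5]. \<forall>x\<in>set [0..5]. \<mu> i x \<in> set [0..5] \<and> \<mu> i (\<mu> i x) = x"
    unfolding \<mu>_def by code_simp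
  have cover: "\<forall>x\<in>set [0..5]. \<forall>y\<in>set [0..5]. x \<noteq> y \<longrightarrow> (\<exists>i\<in>set [0..<5]. \<mu> i x = y)"
    unfolding \<mu>_def by code_simp
  show ?thesis
  proof (rule fillable_starter[of 5 "{}" 6 id \<mu>])
    show "\<mu> i x \<in> {0..<int 6} \<and> \<mu> i (\<mu> i x) = x" if "i < 5" "x \<in> {0..<int 6}" for i x
      using involution[rule_format, of i x] that by simp
    show "(y - x) mod int 6 \<in> differences 6 id {} \<or> (\<exists>i<5. \<mu> i x = y)"
      if "x \<in> {0..<int 6}" "y \<in> {0..<int 6}" "x \<noteq> y" for x y
      using cover[rule_format, of x y] that by auto
  qed auto
qed

text \<open>The differences \<open>\<plusminus>2\<close> and \<open>5\<close> form a prism over a pentagon; its three matchings are the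
  last three rows.\<close>
lemma fillable_10_7: "fillable 10 7"
proof -
  define \<mu> :: "nat \<Rightarrow> int \<Rightarrow> int" where "\<mu> i x =
    [[1, 0, 3, 2, 5, 4, 7, 6, 9, 8], [3, 8, 5, 0, 7, 2, 9, 4, 1, 6],
     [7, 4, 9, 6, 1, 8, 3, 0, 5, 2], [9, 2, 1, 4, 3, 6, 5, 8, 7, 0],
     [2, 9, 0, 8, 6, 7, 4, 5, 3, 1], [5, 3, 4, 1, 2, 0, 8, 9, 6, 7], [8, 6, 7, 5, 9, 3, 1, 2, 0, 4]]
     ! i ! nat x" for i x
  have involution: "\<forall>i\<in>set [0..<7]. \<forall>x\<in>set [0..9]. \<mu> i x \<in> set [0..9] \<and> \<mu> i (\<mu> i x) = x"
    unfolding \<mu>_def by code_simp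
  have cover: "\<forall>x\<in>set [0..9]. \<forall>y\<in>set [0..9]. x \<noteq> y \<longrightarrow>
      (\<exists>t\<in>set [2, 8]. (10 - t - t) mod 10 = (y - x) mod 10) \<or> (\<exists>i\<in>set [0..<7]. \<mu> i x = y)"
    unfolding \<mu>_def by code_simp
  show ?thesis
  proof (rule fillable_starter[of 7 "{2, 8}" 10 "\<lambda>t. 10 - t" \<mu>])
    show "\<mu> i x \<in> {0..<int 10} \<and> \<mu> i (\<mu> i x) = x" if "i < 7" "x \<in> {0..<int 10}" for i x
      using involution[rule_format, of i x] that by simp
    show "(y - x) mod int 10 \<in> differences 10 (\<lambda>t. 10 - t) {2, 8} \<or> (\<exists>i<7. \<mu> i x = y)"
      if "x \<in> {0..<int 10}" "y \<in> {0..<int 10}" "x \<noteq> y" for x y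
      using cover[rule_format, of x y] that by (auto simp: differences_def)
  qed auto
qed

section \<open>Elementary abelian groups\<close>

class exponent2 = ab_group_add +
  assumes add_self_eq_0: "x + x = 0"
begin

lemma add_add_cancel: "x + (x + y) = y" "x + (y + x) = y"
  using add_self_eq_0[of x] by (simp_all add: add.assoc[symmetric] add.commute[of y])

lemma add_eq_0_iff_eq: "x + y = 0 \<longleftrightarrow> x = y"
  using add_add_cancel(1)[of x y] add_self_eq_0[of x] by (metis add_0_right)

end

definition fano_product :: "'a \<Rightarrow> 'a \<Rightarrow> 'a::exponent2" where
  "fano_product x y = (if x = y then x else x + y)"

lemma ci_quasigroup_fano: "ci_quasigroup (UNIV - {0 :: 'a::{exponent2, finite}}) fano_product"
proof
  show "y = z" if "x \<in> UNIV - {0}" "y \<in> UNIV - {0}" "z \<in> UNIV - {0}"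
    "fano_product x y = fano_product x z" for x y z :: 'a
    using that by (auto simp: fano_product_def split: if_splits)
qed (auto simp: fano_product_def add_eq_0_iff_eq add.commute)

lemma covered_fano_line:
  fixes x y :: "'a::{exponent2, finite}"
  assumes "4 < CARD('a)" "x \<noteq> 0" "y \<noteq> 0" "x \<noteq> y" "{r, c, s} \<subseteq> {x, y, x + y}"
  shows "covered (UNIV - {0}) fano_product r c s"
proof (rule covered.closed)
  have "card {x, y, x + y} \<le> 3" by (simp add: card_insert_if)
  moreover have "card (UNIV - {0 :: 'a}) = CARD('a) - 1" by (simp add: card_Diff_subset)
  ultimately have "card {x, y, x + y} < card (UNIV - {0 :: 'a})" using assms(1) by linarith
  then have "{x, y, x + y} \<noteq> UNIV - {0}" by (metis less_irrefl)
  moreover have "{x, y, x + y} \<subseteq> UNIV - {0}" using assms(2-4) by (auto simp: add_eq_0_iff_eq)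
  ultimately show "{x, y, x + y} \<subset> UNIV - {0}" by (rule psubsetI[rotated])
  show "fano_product a b \<in> {x, y, x + y}" if "a \<in> {x, y, x + y}" "b \<in> {x, y, x + y}" for a b
    using that add_add_cancel(1)[of x y] add_add_cancel(1)[of y x]
    by (auto simp: fano_product_def add.commute)
qed (use assms(5) in auto)

lemma covered_fano_noncollinear:
  fixes r c s :: "'a::{exponent2, finite}"
  assumes "r \<noteq> 0" "c \<noteq> 0" "s \<noteq> 0" "r \<noteq> c" "s \<notin> {r, c, r + c}"
  shows "covered (UNIV - {0}) fano_product r c s"
proof (rule covered.disjoint)
  have ne: "r + s \<noteq> c" "c + s \<noteq> r" "r + s \<noteq> 0" "c + s \<noteq> 0"
    using assms(5) add_add_cancel(1)[of r s] add_add_cancel(1)[of c s]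
    by (auto simp: add_eq_0_iff_eq add.commute)
  have sum: "r + (r + s) = s" "c + s + c = s" "c + s + (r + s) = r + c"
    using add_add_cancel(1)[of r s] add_add_cancel(2)[of c s] add_add_cancel(2)[of s "c + r"]
    by (simp_all add: ac_simps)
  show "fano_product x y \<in> {s, r + c}" if "x \<in> {r, c + s}" "y \<in> {c, r + s}" for x y
    using that assms(3,4) ne sum by (auto simp: fano_product_def)
  show "{r, c + s} \<inter> {c, r + s} = {}" using assms ne by auto
  show "card {r, c + s} = card {c, r + s}" "card {s, r + c} = card {r, c + s}"
    using assms ne by (auto simp: card_insert_if)
  show "{r, c + s} \<subseteq> UNIV - {0}" "{c, r + s} \<subseteq> UNIV - {0}" using assms ne by auto
qed simp_all

lemma covered_order_exponent2:
  assumes "4 < CARD('a::{exponent2, finite})"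
  shows "covered_order (CARD('a) - 1)"
proof -
  have "covered (UNIV - {0}) fano_product r c s"
    if rcs: "r \<noteq> 0" "c \<noteq> 0" "s \<noteq> (0 :: 'a)" for r c s
  proof -
    note line = covered_fano_line[OF assms]
    consider (equal_rc) "r = c" "s \<noteq> r" | (equal) "r = c" "s = r"
      | (collinear) "r \<noteq> c" "s \<in> {r, c, r + c}" | (noncollinear) "r \<noteq> c" "s \<notin> {r, c, r + c}"
      by blast
    then show ?thesis
    proof cases
      case equal_rc
      then show ?thesis using rcs by (intro line[of r s]) auto
    next
      case equal
      have "card {0, r} \<le> 2" by (simp add: card_insert_if)
      then have "{0, r} \<noteq> UNIV" using assms by auto
      then obtain y where "y \<noteq> 0" "y \<noteq> r" by auto
      then show ?thesis using equal rcs by (intro line[of r y]) auto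
    next
      case collinear
      then show ?thesis using rcs by (intro line[of r c]) auto
    next
      case noncollinear
      then show ?thesis using rcs by (intro covered_fano_noncollinear)
    qed
  qed
  then have "triple_covered (UNIV - {0 :: 'a}) fano_product" by (simp add: triple_covered_def)
  from covered_orderI[OF ci_quasigroup_fano this] show ?thesis by (simp add: card_Diff_subset)
qed

class exponent3 = ab_group_add +
  assumes add_triple: "x + x + x = 0"

lemma add_self: "x + x = - (x :: 'a::exponent3)"
  by (simp only: eq_neg_iff_add_eq_0 add_triple)

lemma minus_minus_self: "- x - x = (x :: 'a::exponent3)"
  by (metis add_self minus_add_distrib minus_minus uminus_add_conv_diff add.commute)

lemma third_eq_first_iff: "- x - y = x \<longleftrightarrow> x = (y :: 'a::exponent3)"
proof -
  have "- x - y = x \<longleftrightarrow> - x - x = y" by (auto simp: algebra_simps)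
  then show ?thesis by (simp add: minus_minus_self)
qed

lemma neg_eq_self_iff: "- x = x \<longleftrightarrow> x = (0 :: 'a::exponent3)"
  using add_triple[of x] by (metis add.right_inverse add_0 minus_zero)

definition coset :: "'a::exponent3 \<Rightarrow> 'a \<Rightarrow> 'a set" where
  "coset x h = {x, x + h, x - h}"

lemma self_in_coset: "x \<in> coset x h"
  by (simp add: coset_def)

lemma coset_eq:
  assumes "y \<in> coset x h"
  shows "coset y h = coset x h"
proof -
  have "x + h + h = x - h" by (simp add: add.assoc add_self)
  moreover have "x - h - h = x + h" by (metis diff_diff_add add_self diff_minus_eq_add)
  ultimately show ?thesis using assms by (auto simp: coset_def)
qed

lemma coset_disjoint: "y \<notin> coset x h \<Longrightarrow> coset x h \<inter> coset y h = {}"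
  using coset_eq self_in_coset by blast

lemma coset_add:
  assumes "a \<in> coset x h" "b \<in> coset y h"
  shows "a + b \<in> coset (x + y) h"
proof -
  have "h + h = - h" "- h - h = h" by (rule add_self, rule minus_minus_self)
  then show ?thesis using assms by (auto simp: coset_def algebra_simps)
qed

lemma coset_uminus: "a \<in> coset x h \<Longrightarrow> - a \<in> coset (- x) h"
  by (auto simp: coset_def)

lemma coset_third:
  assumes "a \<in> coset x h" "b \<in> coset y h"
  shows "- a - b \<in> coset (- x - y) h"
  using coset_add[OF coset_uminus[OF assms(1)] coset_uminus[OF assms(2)]] by simp

lemma card_coset:
  assumes "h \<noteq> 0"
  shows "card (coset x h) = 3"
proof -
  have "h \<noteq> - h" using assms neg_eq_self_iff[of h] by auto
  then have "x + h \<noteq> x - h" by (metis add_left_cancel diff_conv_add_uminus)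
  then show ?thesis using assms by (simp add: coset_def)
qed

lemma coset_sum_third:
  assumes "a \<in> coset x (x + y + z)" "b \<in> coset y (x + y + z)"
  shows "- a - b \<in> coset z (x + y + z)"
proof -
  have "- x - y \<in> coset z (x + y + z)" by (simp add: coset_def)
  then show ?thesis using coset_third[OF assms] coset_eq by blast
qed

lemma ci_quasigroup_affine: "ci_quasigroup (UNIV :: 'a::{exponent3, finite} set) (\<lambda>x y. - x - y)"
  by standard (auto simp: minus_minus_self)

lemma covered_affine_line:
  fixes r h :: "'a::{exponent3, finite}"
  assumes "3 < CARD('a)" "c \<in> coset r h" "s \<in> coset r h"
  shows "covered UNIV (\<lambda>x y. - x - y) r c s"
proof (rule covered.closed)
  have "card (coset r h) \<le> 3" by (simp add: coset_def card_insert_if)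
  then show "coset r h \<subset> UNIV" using assms(1) by auto
  show "- x - y \<in> coset r h" if "x \<in> coset r h" "y \<in> coset r h" for x y
    using coset_third[OF that] by (simp add: minus_minus_self)
qed (use assms(2,3) self_in_coset in auto)

lemma covered_order_exponent3:
  assumes "3 < CARD('a::{exponent3, finite})"
  shows "covered_order CARD('a)"
proof -
  have "covered UNIV (\<lambda>x y. - x - y) r c s" for r c s :: 'a
  proof -
    define h where "h = r + c + s"
    consider (sum_zero) "h = 0" | (same_coset) "c \<in> coset r h"
      | (distinct_cosets) "h \<noteq> 0" "c \<notin> coset r h" by blast
    then show ?thesis
    proof cases
      case sum_zero
      then have "s = - r - c" by (simp add: h_def add_eq_0_iff)
      also have "\<dots> = r - (c - r)" using add_self[of r] by (simp add: algebra_simps)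
      finally show ?thesis
        by (intro covered_affine_line[OF assms, where h = "c - r"]) (simp_all add: coset_def)
    next
      case same_coset
      have "- r - c \<in> coset s h" by (simp add: h_def coset_def)
      moreover have "- r - c \<in> coset r h"
        using coset_third[OF self_in_coset same_coset, of r] by (simp add: minus_minus_self)
      ultimately have "s \<in> coset r h" using coset_eq self_in_coset by blast
      then show ?thesis using same_coset by (intro covered_affine_line[OF assms])
    next
      case distinct_cosets
      have "- x - y \<in> coset s h" if "x \<in> coset r h" "y \<in> coset c h" for x y
        using that unfolding h_def by (rule coset_sum_third)
      then show ?thesis
        using coset_disjoint[OF distinct_cosets(2)] card_coset[OF distinct_cosets(1)]
        by (intro covered.disjoint[of "coset r h" _ "coset c h" "coset s h"])
          (simp_all add: self_in_coset)
    qed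
  qed
  then have "triple_covered (UNIV :: 'a set) (\<lambda>x y. - x - y)" by (simp add: triple_covered_def)
  from covered_orderI[OF ci_quasigroup_affine this] show ?thesis .
qed

definition additive_subgroup :: "'a::ab_group_add set \<Rightarrow> bool" where
  "additive_subgroup S \<longleftrightarrow> 0 \<in> S \<and> (\<forall>a\<in>S. \<forall>b\<in>S. a - b \<in> S)"

lemma
  assumes "additive_subgroup S"
  shows additive_subgroup_zero: "0 \<in> S"
    and additive_subgroup_diff: "\<lbrakk>a \<in> S; b \<in> S\<rbrakk> \<Longrightarrow> a - b \<in> S"
    and additive_subgroup_uminus: "a \<in> S \<Longrightarrow> - a \<in> S"
    and additive_subgroup_add: "\<lbrakk>a \<in> S; b \<in> S\<rbrakk> \<Longrightarrow> a + b \<in> S"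
proof -
  have diff: "a - b \<in> S" if "a \<in> S" "b \<in> S" for a b
    using assms that by (simp add: additive_subgroup_def)
  show zero: "0 \<in> S" using assms by (simp add: additive_subgroup_def)
  show "a - b \<in> S" if "a \<in> S" "b \<in> S" using that by (rule diff)
  show "- a \<in> S" if "a \<in> S" for a using diff[OF zero that] by simp
  then show "a + b \<in> S" if "a \<in> S" "b \<in> S" using diff[of a "- b"] that by simp
qed

lemma coset_Int_subgroup:
  fixes d :: "'a::exponent3"
  assumes "additive_subgroup S" "d \<notin> S" "u \<in> coset t d" "u \<in> S" "t \<in> S"
  shows "u = t"
proof -
  have "u - t \<in> {0, d, - d}" using assms(3) by (auto simp: coset_def)
  moreover have "u - t \<in> S" using assms(1,4,5) by (intro additive_subgroup_diff)
  ultimately show ?thesis using assms(2) additive_subgroup_uminus[OF assms(1), of "- d"] by auto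
qed

lemma ex_additive_subgroup:
  fixes x y :: "'a::exponent3"
  obtains S where "additive_subgroup S" "x \<in> S" "y \<in> S" "card S \<le> 9"
proof
  let ?S = "(\<lambda>(a, b). a + b) ` (coset 0 x \<times> coset 0 y)"
  have diff: "a - b \<in> coset 0 h" if "a \<in> coset 0 h" "b \<in> coset 0 h" for a b h :: 'a
    using coset_add[OF that(1) coset_uminus[OF that(2)]] by simp
  have zero: "0 \<in> coset 0 h" for h :: 'a by (rule self_in_coset)
  show "additive_subgroup ?S"
    unfolding additive_subgroup_def
  proof (intro conjI ballI)
    show "0 \<in> ?S" using zero by (intro image_eqI[of _ _ "(0, 0)"]) auto
    fix u v assume "u \<in> ?S" "v \<in> ?S"
    then obtain a b a' b' where "a \<in> coset 0 x" "b \<in> coset 0 y" "u = a + b"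
        "a' \<in> coset 0 x" "b' \<in> coset 0 y" "v = a' + b'" by auto
    then show "u - v \<in> ?S" using diff by (intro image_eqI[of _ _ "(a - a', b - b')"]) auto
  qed
  show "x \<in> ?S" by (rule image_eqI[of _ _ "(x, 0)"]) (simp_all add: coset_def)
  show "y \<in> ?S" by (rule image_eqI[of _ _ "(0, y)"]) (simp_all add: coset_def)
  have "card (coset 0 h) \<le> 3" for h :: 'a by (simp add: coset_def card_insert_if)
  then have "card (coset 0 x) * card (coset 0 y) \<le> 3 * 3" by (intro mult_le_mono)
  moreover have "card ?S \<le> card (coset 0 x \<times> coset 0 y)"
    by (rule card_image_le) (simp add: coset_def)
  ultimately show "card ?S \<le> 9" by (simp add: card_cartesian_product)
qed

context
  assumes card_gt_9: "9 < CARD('a::{exponent3, finite})"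
begin

lemma frame_nonzero: "frame (UNIV - {0 :: 'a}) (\<lambda>v. {v, - v}) (\<lambda>u v. - u - v)"
proof
  have "card {0 :: 'a} < CARD('a)" using card_gt_9 by simp
  then have "UNIV \<noteq> {0 :: 'a}" by (metis less_irrefl)
  then show "UNIV - {0 :: 'a} \<noteq> {}" by blast
next
  fix x y :: 'a assume "x \<in> UNIV - {0}" "y \<in> UNIV - {0}" "{x, - x} \<noteq> {y, - y}"
  then have "y \<noteq> x" "y \<noteq> - x" "y \<noteq> 0" by auto
  then show "- x - y \<in> UNIV - {0}" by (auto simp: diff_eq_eq)
  have "- x - y \<noteq> x" using \<open>y \<noteq> x\<close> by (auto simp: third_eq_first_iff)
  moreover have "- x - y \<noteq> - x" using \<open>y \<noteq> 0\<close> by simp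
  ultimately show "{- x - y, - (- x - y)} \<noteq> {x, - x}" by blast
  show "- x - y = - y - x" by (simp add: algebra_simps)
qed auto

interpretation frame "UNIV - {0 :: 'a}" "\<lambda>v. {v, - v}" "\<lambda>u v. - u - v"
  by (rule frame_nonzero)

lemma flat_subgroup:
  assumes "additive_subgroup (S :: 'a set)" "card S \<le> 9"
  shows "flat (S - {0})"
proof -
  have "S \<noteq> UNIV" using assms(2) card_gt_9 by auto
  then have "S - {0} \<subset> UNIV - {0}" using additive_subgroup_zero[OF assms(1)] by blast
  moreover have "v \<in> S - {0}" if "u \<in> S - {0}" "v \<in> UNIV - {0}" "{u, - u} = {v, - v}" for u v
    using that additive_subgroup_uminus[OF assms(1), of u] by (auto simp: doubleton_eq_iff)
  moreover have "- u - v \<in> S - {0}" if "u \<in> S - {0}" "v \<in> S - {0}" "{u, - u} \<noteq> {v, - v}" for u v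
    using that additive_subgroup_diff[OF assms(1), of "- u" v]
      additive_subgroup_uminus[OF assms(1), of u] h_closed[of u v] by auto
  ultimately show ?thesis unfolding flat_def by blast
qed

lemma frame_covered_outside_subgroup:
  fixes x y z :: 'a
  assumes S: "additive_subgroup S" "x \<in> S" "y \<in> S" "z \<notin> S"
    and "x \<noteq> 0" "y \<noteq> 0" and ne: "{x, - x} \<noteq> {y, - y}"
  shows "frame_covered x y z"
proof -
  define d where "d = x + y + z"
  have "0 \<in> S" "x + y \<in> S" using S additive_subgroup_zero additive_subgroup_add by blast+
  have "z = d - (x + y)" by (simp add: d_def)
  then have "d \<notin> S" using S(1,4) \<open>x + y \<in> S\<close> by (auto dest: additive_subgroup_diff)
  note coset_S = coset_Int_subgroup[OF S(1) \<open>d \<notin> S\<close>]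
  show ?thesis
  proof (rule frame_covered.disjoint)
    show "coset x d \<subseteq> UNIV - {0}" "coset y d \<subseteq> UNIV - {0}"
      using coset_S[of 0] \<open>0 \<in> S\<close> assms by auto
    show "(\<lambda>v. {v, - v}) ` coset x d \<inter> (\<lambda>v. {v, - v}) ` coset y d = {}"
    proof (rule ccontr)
      assume "(\<lambda>v. {v, - v}) ` coset x d \<inter> (\<lambda>v. {v, - v}) ` coset y d \<noteq> {}"
      then obtain u v where uv: "u \<in> coset x d" "v \<in> coset y d" "u = v \<or> u = - v"
        by (auto simp: doubleton_eq_iff)
      then have "0 \<in> coset (x + - y) d \<or> 0 \<in> coset (x + y) d"
        using coset_add[OF uv(1) coset_uminus[OF uv(2)]] coset_add[OF uv(1,2)] by auto
      moreover have "x + - y \<in> S" using additive_subgroup_diff[OF S(1-3)] by simp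
      ultimately have "0 = x + - y \<or> 0 = x + y" using coset_S \<open>0 \<in> S\<close> \<open>x + y \<in> S\<close> by blast
      then have "y = x \<or> y = - x" by (auto simp: add_eq_0_iff)
      then show False using ne by auto
    qed
    have "d \<noteq> 0" using \<open>d \<notin> S\<close> \<open>0 \<in> S\<close> by auto
    then show "card (coset x d) = card (coset y d)" "card (coset z d) = card (coset x d)"
      by (simp_all add: card_coset)
    show "- u - v \<in> coset z d" if "u \<in> coset x d" "v \<in> coset y d" for u v
      using that unfolding d_def by (rule coset_sum_third)
  qed (rule self_in_coset)+
qed

lemma frame_covered_nonzero:
  fixes x y z :: 'a
  assumes "x \<noteq> 0" "y \<noteq> 0" "z \<noteq> 0"
  shows "frame_covered x y z"
proof -
  have in_subgroup: "frame_covered x y z"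
    if "additive_subgroup S" "card S \<le> 9" "x \<in> S" "y \<in> S" "z \<in> S" for S
    using flat_subgroup[OF that(1,2)] by (rule frame_covered.flat) (use that assms in auto)
  show ?thesis
  proof (cases "{x, - x} = {y, - y}")
    case True
    obtain S where S: "additive_subgroup S" "x \<in> S" "z \<in> S" "card S \<le> 9"
      using ex_additive_subgroup[of x z] by blast
    then have "y \<in> S"
      using True additive_subgroup_uminus[OF S(1), of x] by (auto simp: doubleton_eq_iff)
    then show ?thesis using S by (intro in_subgroup)
  next
    case False
    obtain S where S: "additive_subgroup S" "x \<in> S" "y \<in> S" "card S \<le> 9"
      using ex_additive_subgroup[of x y] by blast
    then show ?thesis
      using False assms in_subgroup frame_covered_outside_subgroup by (cases "z \<in> S") auto
  qed
qed

lemma covered_order_nonzero: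
  assumes "fillable (2 * m) w" "0 < m"
  shows "covered_order ((CARD('a) - 1) * m + w)"
proof -
  have "card {v \<in> UNIV - {0}. {v, - v} = {u, - u}} = 2" if "u \<noteq> 0" for u :: 'a
  proof -
    have "{v \<in> UNIV - {0}. {v, - v} = {u, - u}} = {u, - u}"
      using that by (auto simp: doubleton_eq_iff)
    then show ?thesis using that neg_eq_self_iff[of u] by (auto simp: card_insert_if)
  qed
  then have "covered_order (card (UNIV - {0 :: 'a}) * m + w)"
    using assms frame_covered_nonzero by (intro covered_order_weighted[where k = 2]) auto
  then show ?thesis by (simp add: card_Diff_subset)
qed

end

section \<open>Orders from spaces over small fields\<close>

datatype z3 = Z0 | Z1 | Z2

instantiation z3 :: comm_ring_1
begin

definition "0 = Z0"
definition "1 = Z1"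

fun plus_z3 :: "z3 \<Rightarrow> z3 \<Rightarrow> z3" where
  "plus_z3 Z0 y = y" | "plus_z3 x Z0 = x"
| "plus_z3 Z1 Z1 = Z2" | "plus_z3 Z2 Z2 = Z1" | "plus_z3 Z1 Z2 = Z0" | "plus_z3 Z2 Z1 = Z0"

fun times_z3 :: "z3 \<Rightarrow> z3 \<Rightarrow> z3" where
  "times_z3 Z0 y = Z0" | "times_z3 x Z0 = Z0"
| "times_z3 Z1 Z1 = Z1" | "times_z3 Z2 Z2 = Z1" | "times_z3 Z1 Z2 = Z2" | "times_z3 Z2 Z1 = Z2"

fun uminus_z3 :: "z3 \<Rightarrow> z3" where
  "uminus_z3 Z0 = Z0" | "uminus_z3 Z1 = Z2" | "uminus_z3 Z2 = Z1"

definition minus_z3 :: "z3 \<Rightarrow> z3 \<Rightarrow> z3" where "minus_z3 x y = x + - y"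

instance
proof
  fix a b c :: z3
  show "a + b + c = a + (b + c)" by (cases a; cases b; cases c) simp_all
  show "a + b = b + a" by (cases a; cases b) simp_all
  show "0 + a = a" by (simp add: zero_z3_def)
  show "- a + a = 0" by (cases a) (simp_all add: zero_z3_def)
  show "a - b = a + - b" by (rule minus_z3_def)
  show "a * b * c = a * (b * c)" by (cases a; cases b; cases c) simp_all
  show "a * b = b * a" by (cases a; cases b) simp_all
  show "1 * a = a" by (cases a) (simp_all add: one_z3_def)
  show "(a + b) * c = a * c + b * c" by (cases a; cases b; cases c) simp_all
  show "(0::z3) \<noteq> 1" by (simp add: zero_z3_def one_z3_def)
qed

end

instance z3 :: exponent3
proof
  fix a :: z3
  show "a + a + a = 0" by (cases a) (simp_all add: zero_z3_def)
qed

lemma UNIV_z3: "UNIV = {Z0, Z1, Z2}"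
  using z3.exhaust by auto

instance z3 :: finite
  by standard (simp add: UNIV_z3)

lemma card_z3: "CARD(z3) = 3"
  by (simp add: UNIV_z3)

lemma z3_square: "x \<noteq> 0 \<Longrightarrow> x * x = (1 :: z3)"
  by (cases x) (simp_all add: zero_z3_def one_z3_def)

lemma z3_third_unique: "\<lbrakk>i \<noteq> j; k \<noteq> i; k \<noteq> j\<rbrakk> \<Longrightarrow> k = - i - (j :: z3)"
  by (cases i; cases j; cases k) (simp_all add: minus_z3_def zero_z3_def)

instance prod :: (exponent3, exponent3) exponent3
  by standard (simp add: prod_eq_iff add_triple)

instance prod :: (exponent2, exponent2) exponent2
  by standard (simp add: prod_eq_iff add_self_eq_0)

lemma UNIV_bit: "(UNIV :: bit set) = {0, 1}"
  by (auto intro: bit.exhaust)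

instance bit :: "{exponent2, finite}"
  by standard (simp_all add: UNIV_bit)

lemma card_bit: "CARD(bit) = 2"
  by (simp add: UNIV_bit)

lemma covered_order_7: "covered_order 7"
  using covered_order_exponent2[where 'a = "bit \<times> bit \<times> bit"] by (simp add: card_bit)

lemma covered_order_15: "covered_order 15"
  using covered_order_exponent2[where 'a = "bit \<times> bit \<times> bit \<times> bit"] by (simp add: card_bit)

lemma covered_order_9: "covered_order 9"
  using covered_order_exponent3[where 'a = "z3 \<times> z3"] by (simp add: card_z3)

lemma covered_order_27: "covered_order 27"
  using covered_order_exponent3[where 'a = "z3 \<times> z3 \<times> z3"] by (simp add: card_z3)

lemma covered_order_mult_26:
  assumes "fillable (2 * m) w" "0 < m"
  shows "covered_order (26 * m + w)"
  using covered_order_nonzero[where 'a = "z3 \<times> z3 \<times> z3", OF _ assms] by (simp add: card_z3)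

section \<open>Tripling along a common part\<close>

lemma affine_interpolation:
  fixes i j u v :: z3
  assumes "i \<noteq> j"
  obtains c d where "c + i * d = u" "c + j * d = v"
proof
  define d where "d = (v - u) * (j - i)"
  have "(j - i) * (j - i) = 1" using assms by (intro z3_square) simp
  then have "(v - u) * ((j - i) * (j - i)) = v - u" by simp
  then show "(u - i * d) + j * d = v" by (simp add: d_def algebra_simps)
qed simp

locale tripling =
  fixes D :: "'d set" and W :: "'w set" and q :: "'d + 'w \<Rightarrow> 'd + 'w \<Rightarrow> 'd + 'w"
    and g :: "'d \<Rightarrow> 'd \<Rightarrow> 'd" and \<kappa> :: "'p \<Rightarrow> 'd \<Rightarrow> z3" and F :: "'p \<Rightarrow> 'w set"
  assumes ci_quasigroup_q: "ci_quasigroup (D <+> W) q"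
    and core_closed: "\<lbrakk>i \<in> W; j \<in> W\<rbrakk> \<Longrightarrow> q (Inr i) (Inr j) \<in> Inr ` W"
    and g_closed: "\<lbrakk>x \<in> D; y \<in> D\<rbrakk> \<Longrightarrow> g x y \<in> D"
    and g_comm: "\<lbrakk>x \<in> D; y \<in> D\<rbrakk> \<Longrightarrow> g x y = g y x"
    and g_g: "\<lbrakk>x \<in> D; y \<in> D\<rbrakk> \<Longrightarrow> g x (g x y) = y"
    and \<kappa>_g: "\<lbrakk>x \<in> D; y \<in> D\<rbrakk> \<Longrightarrow> \<kappa> p (g x y) = - \<kappa> p x - \<kappa> p y"
    and class_closed: "\<lbrakk>u \<in> {x \<in> D. \<kappa> p x = k} <+> F p; v \<in> {x \<in> D. \<kappa> p x = k} <+> F p\<rbrakk> \<Longrightarrow>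
        q u v \<in> {x \<in> D. \<kappa> p x = k} <+> F p"
    and F_subset: "F p \<subseteq> W"
    and F_cover: "i \<in> W \<Longrightarrow> \<exists>p. i \<in> F p"
    and ex_common_class: "\<lbrakk>x \<in> D; y \<in> D\<rbrakk> \<Longrightarrow> \<exists>p. \<kappa> p x = \<kappa> p y"
    and ex_other_class: "\<exists>x\<in>D. \<kappa> p x \<noteq> k"
begin

definition cross_product :: "z3 \<times> 'd \<Rightarrow> z3 \<times> 'd \<Rightarrow> z3 \<times> 'd" where
  "cross_product x y = (- fst x - fst y, g (snd x) (snd y))"

definition embed :: "z3 \<Rightarrow> 'd + 'w \<Rightarrow> (z3 \<times> 'd) + 'w" where
  "embed i = map_sum (Pair i) id"

lemma embed_simps [simp]: "embed i (Inl x) = Inl (i, x)" "embed i (Inr j) = Inr j"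
  by (simp_all add: embed_def)

lemma inj_embed: "inj_on (embed i) A"
  unfolding embed_def by (rule inj_on_subset[OF sum.inj_map]) (auto simp: inj_def)

definition copy :: "z3 \<Rightarrow> (z3 \<times> 'd) + 'w \<Rightarrow> (z3 \<times> 'd) + 'w \<Rightarrow> (z3 \<times> 'd) + 'w" where
  "copy i = transport (embed i) (D <+> W) q"

lemma copy_embed: "\<lbrakk>u \<in> D <+> W; v \<in> D <+> W\<rbrakk> \<Longrightarrow> copy i (embed i u) (embed i v) = embed i (q u v)"
  unfolding copy_def by (rule transport_apply[OF inj_embed])

lemma embed_image: "embed i ` (A <+> B) = ({i} \<times> A) <+> B"
  by (auto simp: Plus_def image_Un image_image)

lemma D_nonempty: "D \<noteq> {}"
  using ex_other_class by blast

lemma frame_cross_product: "frame (UNIV \<times> D) fst cross_product"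
proof
  have "finite D"
    using ci_quasigroup.finite_carrier[OF ci_quasigroup_q]
    by (simp add: finite_Plus_iff)
  then show "finite ((UNIV :: z3 set) \<times> D)" by simp
  show "(UNIV :: z3 set) \<times> D \<noteq> {}" using D_nonempty by simp
next
  fix x y :: "z3 \<times> 'd"
  assume "x \<in> UNIV \<times> D" "y \<in> UNIV \<times> D" and ne: "fst x \<noteq> fst y"
  then have D: "snd x \<in> D" "snd y \<in> D" by (simp_all add: mem_Times_iff)
  show "cross_product x y \<in> UNIV \<times> D" using g_closed[OF D] by (simp add: cross_product_def)
  show "cross_product x y = cross_product y x" using g_comm[OF D] by (simp add: cross_product_def)
  show "fst (cross_product x y) \<noteq> fst x"
    using ne by (simp add: cross_product_def third_eq_first_iff)
next
  fix x y z :: "z3 \<times> 'd"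
  assume "x \<in> UNIV \<times> D" "y \<in> UNIV \<times> D" "z \<in> UNIV \<times> D"
    and eq: "cross_product x y = cross_product x z"
  then have D: "snd x \<in> D" "snd y \<in> D" "snd z \<in> D" by (simp_all add: mem_Times_iff)
  have "g (snd x) (snd y) = g (snd x) (snd z)" using eq by (simp add: cross_product_def)
  then have "snd y = snd z" by (metis g_g[OF D(1,2)] g_g[OF D(1,3)])
  moreover have "fst y = fst z" using eq by (simp add: cross_product_def)
  ultimately show "y = z" by (simp add: prod_eq_iff)
qed

sublocale filled_frame "UNIV \<times> D" fst cross_product W copy "\<lambda>i j. projr (q (Inr i) (Inr j))"
proof (intro filled_frame.intro frame_cross_product filled_frame_axioms.intro)
  fix x :: "z3 \<times> 'd" assume "x \<in> UNIV \<times> D"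
  have "{y \<in> UNIV \<times> D. fst y = fst x} <+> W = embed (fst x) ` (D <+> W)"
    unfolding embed_image by auto
  then show "ci_quasigroup ({y \<in> UNIV \<times> D. fst y = fst x} <+> W) (copy (fst x))"
    unfolding copy_def
    using ci_quasigroup.ci_quasigroup_transport[OF ci_quasigroup_q inj_embed] by simp
  fix i j assume "i \<in> W" "j \<in> W"
  then show "copy (fst x) (Inr i) (Inr j) = Inr (projr (q (Inr i) (Inr j)))"
    using copy_embed[of "Inr i" "Inr j" "fst x"] core_closed[of i j] by (auto simp: InrI)
qed

lemma covered_one_part:
  assumes "{r, c, s} \<subseteq> ({i} \<times> D) <+> W"
  shows "covered points fill r c s"
proof (rule covered_fill_flat)
  have "(i + 1, x) \<in> UNIV \<times> D - {i} \<times> D" if "x \<in> D" for x using that by simp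
  then have "{i} \<times> D \<subset> UNIV \<times> D" using D_nonempty by blast
  then show "flat ({i} \<times> D)" unfolding flat_def by auto
qed (use assms in auto)

lemma covered_three_parts:
  assumes "a \<in> D" "b \<in> D" "e \<in> D" "i \<noteq> j" "k \<noteq> i" "k \<noteq> j"
  shows "covered points fill (Inl (i, a)) (Inl (j, b)) (Inl (k, e))"
proof (rule covered_fill_Inl, rule frame_covered.disjoint)
  show "fst ` ({i} \<times> D) \<inter> fst ` ({j} \<times> D) = {}" using assms(4) by auto
  show "cross_product x y \<in> {k} \<times> D" if "x \<in> {i} \<times> D" "y \<in> {j} \<times> D" for x y
    using that g_closed z3_third_unique[OF assms(4-6)] by (auto simp: cross_product_def)
qed (use assms in \<open>auto simp: card_cartesian_product\<close>)

text \<open>As \<open>- c - c = c\<close>, the classes with values \<open>c + i * d\<close> in the three parts are compatible with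
  the products across parts.\<close>
definition skew :: "'p \<Rightarrow> z3 \<Rightarrow> z3 \<Rightarrow> ((z3 \<times> 'd) + 'w) set" where
  "skew p c d = {x. snd x \<in> D \<and> \<kappa> p (snd x) = c + fst x * d} <+> F p"

lemma skew_closed:
  assumes "u \<in> skew p c d" "v \<in> skew p c d"
  shows "fill u v \<in> skew p c d"
proof -
  have uv: "u \<in> points" "v \<in> points" using assms F_subset by (auto simp: skew_def mem_Times_iff)
  show ?thesis
  proof (cases rule: filled_group_or_cross[OF uv, case_names same cross])
    case (same x)
    define i where "i = fst x"
    let ?class = "{x \<in> D. \<kappa> p x = c + i * d} <+> F p"
    have "w \<in> embed i ` ?class" if "w \<in> filled_group x" "w \<in> skew p c d" for w
      using that unfolding embed_image by (auto simp: skew_def i_def)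
    then obtain u' v' where u'v': "u' \<in> ?class" "v' \<in> ?class" "u = embed i u'" "v = embed i v'"
      using same(2,3) assms by blast
    then have "u' \<in> D <+> W" "v' \<in> D <+> W" using F_subset by auto
    then have "fill u v = embed i (q u' v')"
      using fill_eq_Q[OF same] u'v'(3,4) copy_embed by (simp add: i_def)
    also have "\<dots> \<in> embed i ` ?class" using u'v'(1,2) by (intro imageI class_closed)
    also have "embed i ` ?class \<subseteq> skew p c d" unfolding embed_image by (auto simp: skew_def)
    finally show ?thesis .
  next
    case (cross x y)
    then have D: "snd x \<in> D" "snd y \<in> D"
      and \<kappa>: "\<kappa> p (snd x) = c + fst x * d" "\<kappa> p (snd y) = c + fst y * d"
      using assms by (auto simp: skew_def)
    have "\<kappa> p (g (snd x) (snd y)) = - (c + fst x * d) - (c + fst y * d)"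
      using \<kappa>_g[OF D] \<kappa> by simp
    also have "\<dots> = (- c - c) + (- fst x - fst y) * d" by (simp add: algebra_simps)
    finally show ?thesis
      using cross g_closed[OF D] by (simp add: skew_def cross_product_def minus_minus_self InlI)
  qed
qed

lemma covered_skew:
  assumes "{r, c, s} \<subseteq> skew p a d"
  shows "covered points fill r c s"
proof (rule covered.closed)
  obtain x where "x \<in> D" "\<kappa> p x \<noteq> a" using ex_other_class by blast
  then have "Inl (0, x) \<in> points - skew p a d" by (auto simp: skew_def)
  moreover have "skew p a d \<subseteq> points" using F_subset by (auto simp: skew_def mem_Times_iff)
  ultimately show "skew p a d \<subset> points" by blast
qed (use assms skew_closed in auto)

lemma covered_two_parts:
  assumes "a \<in> D" "b \<in> D" "i \<noteq> j" "t \<in> ({i, j} \<times> D) <+> W" "{r, c, s} \<subseteq> {Inl (i, a), Inl (j, b), t}"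
  shows "covered points fill r c s"
proof -
  obtain p where p: "t \<in> ({i} \<times> {x \<in> D. \<kappa> p x = \<kappa> p a} \<union> {j} \<times> {x \<in> D. \<kappa> p x = \<kappa> p b}) <+> F p"
  proof -
    from assms(4) consider (first) e where "t = Inl (i, e)" "e \<in> D"
      | (second) e where "t = Inl (j, e)" "e \<in> D" | (core) w where "t = Inr w" "w \<in> W" by auto
    then show thesis
    proof cases
      case (first e)
      then obtain p where "\<kappa> p e = \<kappa> p a" using ex_common_class assms(1) by blast
      then show thesis using first by (intro that[of p]) auto
    next
      case (second e)
      then obtain p where "\<kappa> p e = \<kappa> p b" using ex_common_class assms(2) by blast
      then show thesis using second by (intro that[of p]) auto
    next
      case (core w)
      then obtain p where "w \<in> F p" using F_cover by blast
      then show thesis using core by (intro that[of p]) auto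
    qed
  qed
  obtain c0 d where "c0 + i * d = \<kappa> p a" "c0 + j * d = \<kappa> p b"
    using assms(3) by (rule affine_interpolation)
  then have "{Inl (i, a), Inl (j, b), t} \<subseteq> skew p c0 d" using assms(1,2) p by (auto simp: skew_def)
  then show ?thesis using assms(5) by (intro covered_skew) blast
qed

lemma covered_fill_D:
  assumes "a \<in> D" "b \<in> D" "e \<in> D"
  shows "covered points fill (Inl (i, a)) (Inl (j, b)) (Inl (k, e))"
proof -
  consider (one) "i = j" "k = i" | (two) "i = j" "k \<noteq> i" | (two') "i \<noteq> j" "k \<in> {i, j}"
    | (three) "i \<noteq> j" "k \<noteq> i" "k \<noteq> j" by blast
  then show ?thesis
  proof cases
    case one
    then show ?thesis using assms by (intro covered_one_part[where i = i]) auto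
  next
    case two
    then show ?thesis using assms by (intro covered_two_parts[of a e i k "Inl (j, b)"]) auto
  next
    case two'
    then show ?thesis using assms by (intro covered_two_parts[of a b i j "Inl (k, e)"]) auto
  next
    case three
    then show ?thesis using assms by (intro covered_three_parts)
  qed
qed

lemma triple_covered_fill_tripling: "triple_covered points fill"
  unfolding triple_covered_def
proof (intro ballI)
  fix r c s assume "r \<in> points" "c \<in> points" "s \<in> points"
  then consider (all) i a j b k e where "r = Inl (i, a)" "c = Inl (j, b)" "s = Inl (k, e)"
      "a \<in> D" "b \<in> D" "e \<in> D"
    | (two) i a j b w where "{r, c, s} \<subseteq> {Inl (i, a), Inl (j, b), Inr w}" "a \<in> D" "b \<in> D" "w \<in> W"
    | (one) i where "{r, c, s} \<subseteq> ({i} \<times> D) <+> W"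
    by (elim PlusE) (auto, blast+)
  then show "covered points fill r c s"
  proof cases
    case all
    then show ?thesis by (simp add: covered_fill_D)
  next
    case (two i a j b w)
    show ?thesis
    proof (cases "i = j")
      case True
      have "{Inl (i, a), Inl (j, b), Inr w} \<subseteq> ({i} \<times> D) <+> W" using two True by auto
      with two(1) show ?thesis by (intro covered_one_part) (rule subset_trans)
    next
      case False
      then show ?thesis using two by (intro covered_two_parts[of a b i j "Inr w"]) auto
    qed
  next
    case one
    then show ?thesis by (rule covered_one_part)
  qed
qed

lemma covered_order_tripling: "covered_order (3 * card D + card W)"
  using covered_orderI[OF ci_quasigroup_fill triple_covered_fill_tripling]
  by (simp add: card_points card_cartesian_product card_z3)

end

section \<open>Orders 65, 67 and 69\<close>

definition ci_rows :: "'a list \<Rightarrow> 'a list list \<Rightarrow> bool" where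
  "ci_rows xs rows \<longleftrightarrow> map (\<lambda>i. rows ! i ! i) [0..<length xs] = xs \<and> transpose rows = rows \<and>
     list_all (\<lambda>row. distinct row \<and> list_all (\<lambda>y. y \<in> set xs) row) rows"

lemma ci_quasigroup_rows:
  assumes "ci_rows xs (map (\<lambda>x. map (f x) xs) xs)"
  shows "ci_quasigroup (set xs) f"
proof
  let ?rows = "map (\<lambda>x. map (f x) xs) xs"
  have idem: "map (\<lambda>i. ?rows ! i ! i) [0..<length xs] = xs" and sym: "transpose ?rows = ?rows"
    and rows: "\<And>x. x \<in> set xs \<Longrightarrow> distinct (map (f x) xs) \<and> f x ` set xs \<subseteq> set xs"
    using assms by (auto simp: ci_rows_def list_all_iff)
  show "f x x = x" if "x \<in> set xs" for x
  proof -
    from that obtain i where "i < length xs" "x = xs ! i" by (auto simp: in_set_conv_nth)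
    then show ?thesis using arg_cong[OF idem, of "\<lambda>ys. ys ! i"] by simp
  qed
  show "f x y \<in> set xs" if "x \<in> set xs" "y \<in> set xs" for x y using rows that by blast
  show "f x y = f y x" if "x \<in> set xs" "y \<in> set xs" for x y
  proof -
    from that obtain i j where ij: "i < length xs" "x = xs ! i" "j < length xs" "y = xs ! j"
      by (auto simp: in_set_conv_nth)
    have "transpose ?rows = map (\<lambda>i. map (\<lambda>j. ?rows ! j ! i) [0..<length ?rows]) [0..<length xs]"
      by (rule transpose_rectangle) simp_all
    then have "transpose ?rows ! i ! j = ?rows ! j ! i" using ij by simp
    then show ?thesis unfolding sym using ij by simp
  qed
  show "y = z" if "x \<in> set xs" "y \<in> set xs" "z \<in> set xs" "f x y = f x z" for x y z
    using rows[OF that(1)] that(2-4) by (auto simp: distinct_map dest: inj_onD)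
qed simp

type_synonym point = "z3 \<times> z3 \<times> bool"

definition point_list :: "point list" where
  "point_list = List.product [Z0, Z1, Z2] (List.product [Z0, Z1, Z2] [False, True])"

lemma set_point_list: "set point_list = UNIV"
  unfolding point_list_def set_product using UNIV_z3 by (auto simp: UNIV_bool)

text \<open>\<open>None\<close> is the direction of the lines with constant first coordinate, \<open>Some s\<close> that of the
  lines of slope \<open>s\<close>; \<open>line p\<close> separates the parallel lines of direction \<open>p\<close>.\<close>
definition direction_list :: "z3 option list" where
  "direction_list = [None, Some Z0, Some Z1, Some Z2]"

lemma set_direction_list: "set direction_list = UNIV"
proof -
  have "p \<in> set direction_list" for p
  proof (cases p)
    case (Some s)
    then show ?thesis by (cases s) (simp_all add: direction_list_def)
  qed (simp add: direction_list_def)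
  then show ?thesis by blast
qed

definition direction :: "point \<Rightarrow> point \<Rightarrow> z3 option" where
  "direction x y = (case (x, y) of ((a, b, _), (a', b', _)) \<Rightarrow>
     if a = a' then None else Some ((b' - b) * (a' - a)))"

definition line :: "z3 option \<Rightarrow> point \<Rightarrow> z3" where
  "line p x = (case x of (a, b, _) \<Rightarrow> (case p of None \<Rightarrow> a | Some s \<Rightarrow> b - s * a))"

definition param :: "z3 option \<Rightarrow> point \<Rightarrow> z3 \<times> bool" where
  "param p x = (case x of (a, b, i) \<Rightarrow> (case p of None \<Rightarrow> b | Some _ \<Rightarrow> a, i))"

definition line_point :: "z3 option \<Rightarrow> z3 \<Rightarrow> z3 \<times> bool \<Rightarrow> point" where
  "line_point p k u = (case u of (t, i) \<Rightarrow>
     (case p of None \<Rightarrow> (k, t, i) | Some s \<Rightarrow> (t, k + s * t, i)))"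

definition third_point :: "point \<Rightarrow> point \<Rightarrow> point" where
  "third_point x y = (case (x, y) of ((a, b, i), (a', b', j)) \<Rightarrow> (- a - a', - b - b', i \<noteq> j))"

lemma third_point_comm: "third_point x y = third_point y x"
  by (cases x; cases y) (auto simp: third_point_def)

lemma third_point_third_point: "third_point x (third_point x y) = y"
  by (cases x; cases y) (auto simp: third_point_def)

lemma line_third_point: "line p (third_point x y) = - line p x - line p y"
  by (cases x; cases y; cases p) (auto simp: third_point_def line_def algebra_simps)

lemma line_direction: "line (direction x y) x = line (direction x y) y"
proof -
  obtain a b i a' b' j where xy: "x = (a, b, i)" "y = (a', b', j)" by (metis prod.exhaust)
  show ?thesis
  proof (cases "a = a'")
    case True
    then show ?thesis using xy by (simp add: line_def direction_def)
  next
    case False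
    then have "(a' - a) * (a' - a) = 1" by (intro z3_square) simp
    then have "(b' - b) * (a' - a) * (a' - a) = b' - b" by (simp add: mult.assoc)
    then show ?thesis using xy False by (simp add: line_def direction_def algebra_simps)
  qed
qed

lemma ex_line_ne: "\<exists>x. line p x \<noteq> k"
proof (cases p)
  case None
  then show ?thesis by (intro exI[of _ "(k + 1, 0, True)"]) (simp add: line_def)
next
  case (Some s)
  then show ?thesis by (intro exI[of _ "(0, k + 1, True)"]) (simp add: line_def)
qed

definition rotating_matching :: "z3 \<Rightarrow> z3 \<times> bool \<Rightarrow> z3 \<times> bool" where
  "rotating_matching d u = (case u of (t, i) \<Rightarrow> (if i then t + d else t - d, \<not> i))"

definition octahedral_matching :: "z3 \<Rightarrow> z3 \<times> bool \<Rightarrow> z3 \<times> bool" where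
  "octahedral_matching s u = (case u of (t, i) \<Rightarrow>
     if t = s then (if i then s + Z2 else s + Z1, False)
     else if t = s + Z1 then (if i then s + Z2 else s, i)
     else (if i then s + Z1 else s, True))"

text \<open>For \<open>n = 4\<close> the matchings factorize the octahedron with vertices \<open>z3 \<times> bool\<close>.\<close>
definition matchings :: "nat \<Rightarrow> (z3 \<times> bool \<Rightarrow> z3 \<times> bool) list" where
  "matchings n = (if n = 0 then [] else if n = 2 then [rotating_matching Z1, rotating_matching Z2]
     else rotating_matching Z1 # map octahedral_matching [Z0, Z1, Z2])"

text \<open>Besides the points there are \<open>0\<close>, lying on every line, and the elements of \<open>ends p\<close>, lying
  on the lines of direction \<open>p\<close>.  A line, doubled and extended in this way, carries the Fano plane,
  the affine plane of order 3, or a quasigroup made from the octahedron factorization, as \<open>ends p\<close>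
  has 0, 2 or 4 elements.\<close>
definition point_product :: "(z3 option \<Rightarrow> nat list) \<Rightarrow> point \<Rightarrow> point \<Rightarrow> point + nat" where
  "point_product ends x y = (case (x, y) of ((a, b, i), (a', b', j)) \<Rightarrow>
     if a = a' \<and> b = b' then (if i = j then Inl x else Inr 0)
     else let p = direction x y; n = length (ends p) in
       if n = 0 then Inl (third_point x y)
       else if n = 2 \<and> i = j then Inl (- a - a', - b - b', i)
       else Inr (ends p ! the (List.find (\<lambda>e. (matchings n ! e) (param p x) = param p y) [0..<n])))"

definition end_product :: "(z3 option \<Rightarrow> nat list) \<Rightarrow> point \<Rightarrow> nat \<Rightarrow> point" where
  "end_product ends x w = (if w = 0 then (case x of (a, b, i) \<Rightarrow> (a, b, \<not> i)) else
     let p = the (List.find (\<lambda>p. w \<in> set (ends p)) direction_list); n = length (ends p);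
       e = the (List.find (\<lambda>e. ends p ! e = w) [0..<n])
     in line_point p (line p x) ((matchings n ! e) (param p x)))"

fun plane_product ::
  "(z3 option \<Rightarrow> nat list) \<Rightarrow> nat list list \<Rightarrow> point + nat \<Rightarrow> point + nat \<Rightarrow> point + nat" where
  "plane_product ends core (Inl x) (Inl y) = point_product ends x y"
| "plane_product ends core (Inl x) (Inr j) = Inl (end_product ends x j)"
| "plane_product ends core (Inr i) (Inl y) = Inl (end_product ends y i)"
| "plane_product ends core (Inr i) (Inr j) = Inr (core ! i ! j)"

definition extended_line :: "(z3 option \<Rightarrow> nat list) \<Rightarrow> z3 option \<Rightarrow> z3 \<Rightarrow> (point + nat) list" where
  "extended_line ends p k = map Inl (filter (\<lambda>x. line p x = k) point_list) @ map Inr (0 # ends p)"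

definition plane_blocks :: "(z3 option \<Rightarrow> nat list) \<Rightarrow> nat \<Rightarrow> (point + nat) list list" where
  "plane_blocks ends f = map Inr [0..<f] #
     map (\<lambda>(p, k). extended_line ends p k) (List.product direction_list [Z0, Z1, Z2])"

definition plane_check :: "(z3 option \<Rightarrow> nat list) \<Rightarrow> nat list list \<Rightarrow> nat \<Rightarrow> bool" where
  "plane_check ends core f \<longleftrightarrow> set (0 # concat (map ends direction_list)) = set [0..<f] \<and>
     list_all (\<lambda>xs. ci_rows xs (map (\<lambda>x. map (plane_product ends core x) xs) xs))
       (plane_blocks ends f)"

lemma set_extended_line: "set (extended_line ends p k) = {x. line p x = k} <+> set (0 # ends p)"
  by (auto simp: extended_line_def set_point_list)

lemma
  assumes "plane_check ends core f"
  shows ci_quasigroup_extended_line: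
      "ci_quasigroup ({x. line p x = k} <+> set (0 # ends p)) (plane_product ends core)"
    and ci_quasigroup_core: "ci_quasigroup (Inr ` {..<f}) (plane_product ends core)"
    and ends_union: "(\<Union>p. set (0 # ends p)) = {..<f}"
proof -
  have blocks: "ci_quasigroup (set xs) (plane_product ends core)"
    if "xs \<in> set (plane_blocks ends f)" for xs
    using assms that by (intro ci_quasigroup_rows) (simp add: plane_check_def list_all_iff)
  have "k \<in> set [Z0, Z1, Z2]" using UNIV_z3 by auto
  then have "extended_line ends p k \<in> set (plane_blocks ends f)"
    unfolding plane_blocks_def by (force simp: set_direction_list)
  from blocks[OF this]
  show "ci_quasigroup ({x. line p x = k} <+> set (0 # ends p)) (plane_product ends core)"
    by (simp only: set_extended_line)
  have "map Inr [0..<f] \<in> set (plane_blocks ends f)" by (simp add: plane_blocks_def)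
  from blocks[OF this] show "ci_quasigroup (Inr ` {..<f}) (plane_product ends core)"
    by (simp add: atLeast_upt)
  have "insert 0 (\<Union>p. set (ends p)) = {..<f}"
    using assms by (simp add: plane_check_def set_direction_list atLeast_upt)
  then show "(\<Union>p. set (0 # ends p)) = {..<f}" by auto
qed

lemma ci_quasigroup_plane:
  assumes "plane_check ends core f"
  shows "ci_quasigroup (UNIV <+> {..<f}) (plane_product ends core)"
proof (rule ci_quasigroup_of_blocks)
  have line: "\<exists>B. B \<subseteq> UNIV <+> {..<f} \<and> u \<in> B \<and> v \<in> B \<and> ci_quasigroup B (plane_product ends core)"
    if "u \<in> {y. line p y = line p x} <+> set (0 # ends p)"
      "v \<in> {y. line p y = line p x} <+> set (0 # ends p)" for u v p x
  proof -
    have "{y. line p y = line p x} <+> set (0 # ends p) \<subseteq> UNIV <+> {..<f}"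
      using ends_union[OF assms] by blast
    then show ?thesis using that ci_quasigroup_extended_line[OF assms] by blast
  qed
  have ends: "\<exists>p. w \<in> set (0 # ends p)" if "w < f" for w using ends_union[OF assms] that by blast
  fix u v :: "point + nat" assume "u \<in> UNIV <+> {..<f}" "v \<in> UNIV <+> {..<f}"
  then consider (points) x y where "u = Inl x" "v = Inl y"
    | (left) x w where "u = Inl x" "v = Inr w" "w < f"
    | (right) w y where "u = Inr w" "v = Inl y" "w < f"
    | (core) w w' where "u = Inr w" "v = Inr w'" "w < f" "w' < f"
    by auto
  then show "\<exists>B. B \<subseteq> UNIV <+> {..<f} \<and> u \<in> B \<and> v \<in> B \<and> ci_quasigroup B (plane_product ends core)"
  proof cases
    case (points x y)
    then show ?thesis
      using line_direction[of x y] by (intro line[of _ "direction x y" x]) auto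
  next
    case (left x w)
    obtain p where "w \<in> set (0 # ends p)" using ends left(3) by blast
    then show ?thesis using left by (intro line[of _ p x]) auto
  next
    case (right w y)
    obtain p where "w \<in> set (0 # ends p)" using ends right(3) by blast
    then show ?thesis using right by (intro line[of _ p y]) auto
  next
    case (core w w')
    then show ?thesis using ci_quasigroup_core[OF assms] by (intro exI[of _ "Inr ` {..<f}"]) auto
  qed
qed simp

lemma covered_order_plane:
  assumes "plane_check ends core f"
  shows "covered_order (54 + f)"
proof -
  interpret tripling UNIV "{..<f}" "plane_product ends core" third_point line "\<lambda>p. set (0 # ends p)"
  proof (rule tripling.intro)
    show "ci_quasigroup (UNIV <+> {..<f}) (plane_product ends core)"
      using assms by (rule ci_quasigroup_plane)
    show "plane_product ends core (Inr i) (Inr j) \<in> Inr ` {..<f}"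
      if "i \<in> {..<f}" "j \<in> {..<f}" for i j
      using that by (intro ci_quasigroup.closed[OF ci_quasigroup_core[OF assms]]) auto
    show "plane_product ends core u v \<in> {x \<in> UNIV. line p x = k} <+> set (0 # ends p)"
      if "u \<in> {x \<in> UNIV. line p x = k} <+> set (0 # ends p)"
        "v \<in> {x \<in> UNIV. line p x = k} <+> set (0 # ends p)" for u v p k
      using that ci_quasigroup.closed[OF ci_quasigroup_extended_line[OF assms]] by simp
    show "set (0 # ends p) \<subseteq> {..<f}" for p using ends_union[OF assms] by blast
    show "\<exists>p. i \<in> set (0 # ends p)" if "i \<in> {..<f}" for i using ends_union[OF assms] that by blast
    show "\<exists>p. line p x = line p y" for x y using line_direction by blast
    show "\<exists>x\<in>UNIV. line p x \<noteq> k" for p k using ex_line_ne by simp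
  qed (simp_all add: third_point_comm third_point_third_point line_third_point)
  have "covered_order (3 * CARD(point) + card {..<f})" by (rule covered_order_tripling)
  then show ?thesis by (simp add: card_z3)
qed

lemma covered_order_65: "covered_order 65"
proof -
  have "plane_check (\<lambda>p. case p of None \<Rightarrow> [1, 2, 3, 4] |
      Some s \<Rightarrow> (case s of Z0 \<Rightarrow> [5, 6] | Z1 \<Rightarrow> [7, 8] | Z2 \<Rightarrow> [9, 10]))
    [[0, 4, 1, 2, 3, 6, 5, 8, 7, 10, 9],
     [4, 1, 3, 0, 2, 8, 9, 10, 5, 6, 7],
     [1, 3, 2, 4, 0, 10, 8, 9, 6, 7, 5],
     [2, 0, 4, 3, 1, 9, 7, 6, 10, 5, 8],
     [3, 2, 0, 1, 4, 7, 10, 5, 9, 8, 6],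
     [6, 8, 10, 9, 7, 5, 0, 4, 1, 3, 2],
     [5, 9, 8, 7, 10, 0, 6, 3, 2, 1, 4],
     [8, 10, 9, 6, 5, 4, 3, 7, 0, 2, 1],
     [7, 5, 6, 10, 9, 1, 2, 0, 8, 4, 3],
     [10, 6, 7, 5, 8, 3, 1, 2, 4, 9, 0],
     [9, 7, 5, 8, 6, 2, 4, 1, 3, 0, 10]] 11"
    by code_simp
  from covered_order_plane[OF this] show ?thesis by simp
qed

lemma covered_order_67: "covered_order 67"
proof -
  have "plane_check (\<lambda>p. case p of None \<Rightarrow> [] |
      Some s \<Rightarrow> (case s of Z0 \<Rightarrow> [1, 2, 3, 4] | Z1 \<Rightarrow> [5, 6, 7, 8] | Z2 \<Rightarrow> [9, 10, 11, 12]))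
    [[0, 4, 1, 2, 3, 8, 5, 6, 7, 12, 9, 10, 11],
     [4, 1, 3, 0, 2, 10, 9, 12, 11, 6, 5, 8, 7],
     [1, 3, 2, 4, 0, 9, 10, 11, 12, 5, 6, 7, 8],
     [2, 0, 4, 3, 1, 12, 11, 10, 9, 8, 7, 6, 5],
     [3, 2, 0, 1, 4, 11, 12, 9, 10, 7, 8, 5, 6],
     [8, 10, 9, 12, 11, 5, 7, 0, 6, 2, 1, 4, 3],
     [5, 9, 10, 11, 12, 7, 6, 8, 0, 1, 2, 3, 4],
     [6, 12, 11, 10, 9, 0, 8, 7, 5, 4, 3, 2, 1],
     [7, 11, 12, 9, 10, 6, 0, 5, 8, 3, 4, 1, 2],
     [12, 6, 5, 8, 7, 2, 1, 4, 3, 9, 11, 0, 10],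
     [9, 5, 6, 7, 8, 1, 2, 3, 4, 11, 10, 12, 0],
     [10, 8, 7, 6, 5, 4, 3, 2, 1, 0, 12, 11, 9],
     [11, 7, 8, 5, 6, 3, 4, 1, 2, 10, 0, 9, 12]] 13"
    by code_simp
  from covered_order_plane[OF this] show ?thesis by simp
qed

lemma covered_order_69: "covered_order 69"
proof -
  have "plane_check (\<lambda>p. case p of None \<Rightarrow> [13, 14] |
      Some s \<Rightarrow> (case s of Z0 \<Rightarrow> [1, 2, 3, 4] | Z1 \<Rightarrow> [5, 6, 7, 8] | Z2 \<Rightarrow> [9, 10, 11, 12]))
    [[0, 4, 1, 2, 3, 8, 5, 6, 7, 12, 9, 10, 11, 14, 13],
     [4, 1, 3, 0, 2, 11, 12, 14, 10, 13, 8, 5, 6, 9, 7],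
     [1, 3, 2, 4, 0, 9, 10, 11, 14, 5, 6, 7, 13, 12, 8],
     [2, 0, 4, 3, 1, 10, 13, 9, 12, 7, 5, 14, 8, 6, 11],
     [3, 2, 0, 1, 4, 13, 11, 12, 9, 8, 14, 6, 7, 5, 10],
     [8, 11, 9, 10, 13, 5, 7, 0, 6, 2, 3, 1, 14, 4, 12],
     [5, 12, 10, 13, 11, 7, 6, 8, 0, 14, 2, 4, 1, 3, 9],
     [6, 14, 11, 9, 12, 0, 8, 7, 5, 3, 13, 2, 4, 10, 1],
     [7, 10, 14, 12, 9, 6, 0, 5, 8, 4, 1, 13, 3, 11, 2],
     [12, 13, 5, 7, 8, 2, 14, 3, 4, 9, 11, 0, 10, 1, 6],
     [9, 8, 6, 5, 14, 3, 2, 13, 1, 11, 10, 12, 0, 7, 4],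
     [10, 5, 7, 14, 6, 1, 4, 2, 13, 0, 12, 11, 9, 8, 3],
     [11, 6, 13, 8, 7, 14, 1, 4, 3, 10, 0, 9, 12, 2, 5],
     [14, 9, 12, 6, 5, 4, 3, 10, 11, 1, 7, 8, 2, 13, 0],
     [13, 7, 8, 11, 10, 12, 9, 1, 2, 6, 4, 3, 5, 0, 14]] 15"
    by code_simp
  from covered_order_plane[OF this] show ?thesis by simp
qed

section \<open>All orders\<close>

lemma covered_order_53: "covered_order 53"
  using covered_order_mult_26[of 2 1] fillable_even[of 1 2] by simp

lemma covered_order_div_mod_14:
  assumes "odd n" "n mod 14 + 2 * ((n div 14 - 1) div 2) < 2 * (n div 14)"
  shows "covered_order n"
proof -
  have "odd (n mod 14)" using assms(1) by (simp add: dvd_mod_iff)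
  then have "covered_order (7 * (2 * (n div 14)) + n mod 14)"
    using assms(2) by (intro covered_order_weight covered_order_7 fillable_even) auto
  moreover have "7 * (2 * (n div 14)) + n mod 14 = n" by presburger
  ultimately show ?thesis by simp
qed

definition sporadic_orders :: "nat set" where
  "sporadic_orders = {27, 39, 49, 53, 55, 63, 65, 67, 69, 77, 79, 81, 83, 93, 95, 97, 107, 109, 111,
     123, 125, 137, 139, 153, 167}"

lemma covered_order_sporadic:
  assumes "n \<in> sporadic_orders"
  shows "covered_order n"
proof -
  note weight7 = covered_order_weight[OF covered_order_7]
    and weight9 = covered_order_weight[OF covered_order_9]
    and weight15 = covered_order_weight[OF covered_order_15]
  have "covered_order 49" "covered_order 63" "covered_order 77" "covered_order 81"
    using weight7[of 7 0] weight7[of 9 0] weight7[of 11 0] weight9[of 9 0] fillable_odd_0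
    by simp_all
  moreover have "covered_order 39" "covered_order 55" "covered_order 93" "covered_order 95"
    "covered_order 97" "covered_order 109" "covered_order 111" "covered_order 153"
    "covered_order 167"
    using weight9[OF _ fillable_even[of 3 2]] weight9[OF _ fillable_even[of 1 3]]
      weight9[OF _ fillable_even[of 3 5]] weight9[OF _ fillable_even[of 5 5]]
      weight9[OF _ fillable_10_7] weight9[OF _ fillable_even[of 1 6]]
      weight9[OF _ fillable_even[of 3 6]] weight9[OF _ fillable_even[of 9 8]]
      weight9[OF _ fillable_even[of 5 9]] by simp_all
  moreover have "covered_order 79" "covered_order 83" "covered_order 137"
    using covered_order_mult_26[of 3 1] covered_order_mult_26[of 3 5]
      covered_order_mult_26[of 5 7] fillable_even[of 1 3] fillable_6_5 fillable_10_7 by simp_all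
  moreover have "covered_order 107" "covered_order 123" "covered_order 125" "covered_order 139"
    using covered_order_weight[OF covered_order_53 _ fillable_even[of 1 1]]
      weight15[OF _ fillable_even[of 3 4]] weight15[OF _ fillable_even[of 5 4]]
      covered_order_weight[OF covered_order_69 _ fillable_even[of 1 1]] by simp_all
  ultimately show ?thesis
    using assms covered_order_27 covered_order_53 covered_order_65 covered_order_67 covered_order_69
    unfolding sporadic_orders_def by blast
qed

lemma sporadic_orders_complete:
  assumes "odd n" "27 \<le> n" "n \<notin> {33, 35, 37, 41, 43, 47, 51}"
    and not_filled: "\<not> n mod 14 + 2 * ((n div 14 - 1) div 2) < 2 * (n div 14)"
  shows "n \<in> sporadic_orders"
proof -
  define k w where "k = n div 14" and "w = n mod 14"
  have n: "n = 14 * k + w" by (simp add: k_def w_def)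
  have bound: "\<not> w + 2 * ((k - 1) div 2) < 2 * k" using not_filled by (simp add: k_def w_def)
  have "odd w" "w < 14" using assms(1) by (simp_all add: w_def dvd_mod_iff)
  then have w: "w \<in> {1, 3, 5, 7, 9, 11, 13}" by (auto elim!: oddE)
  have "2 * ((k - 1) div 2) \<le> k - 1" by simp
  then have "1 \<le> k" "k < 13" using bound \<open>w < 14\<close> assms(2) n by linarith+
  then have k: "k \<in> {1, 2, 3, 4, 5, 6, 7, 8, 9, 10, 11, 12}"
    unfolding insert_iff empty_iff by presburger
  show ?thesis
    using bound k w assms(2,3) unfolding n sporadic_orders_def by (elim insertE emptyE) simp_all
qed

lemma covered_order_odd:
  assumes "odd n" "27 \<le> n" "n \<notin> {33, 35, 37, 41, 43, 47, 51}"
  shows "covered_order n"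
  using covered_order_div_mod_14[OF assms(1)]
    covered_order_sporadic[OF sporadic_orders_complete[OF assms]] by blast

theorem theorem5p5:
  fixes n :: nat
  assumes "odd n" and "n \<ge> 27" and "n \<notin> {33, 35, 37, 41, 43, 47, 51}"
  shows "\<exists>L. latin_square n L \<and> symmetric_ls n L \<and> idempotent_ls n L \<and>
           (\<forall>r\<in>{1..n}. \<forall>c\<in>{1..n}. \<forall>s\<in>{1..n}.
              \<exists>R C S. proper_latin_subsquare n L R C S \<and> r \<in> R \<and> c \<in> C \<and> s \<in> S)"
proof -
  obtain f where f: "ci_quasigroup {1..n} f" and "triple_covered {1..n} f"
    using covered_order_odd[OF assms] unfolding covered_order_def by blast
  then have "\<exists>R C S. proper_latin_subsquare n f R C S \<and> r \<in> R \<and> c \<in> C \<and> s \<in> S"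
    if "r \<in> {1..n}" "c \<in> {1..n}" "s \<in> {1..n}" for r c s
    using that by (intro covered_imp_proper_latin_subsquare) (simp_all add: triple_covered_def)
  then show ?thesis using ci_quasigroup_imp_latin_square[OF f] by blast
qed

end
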